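(* Let $M$ be a directed-complete effect monoid. Then there exists an extremally-disconnected compact Hausdorff space $X$ and a complete Boolean algebra $B$ such that $M\cong [0,1]_{C(X)} \oplus B$.
   Context: An effect algebra is a set $E$ with an element $0$, a partial binary operation $a+b$ (the partial sum), and a total complement $a\mapsto a^\perp$, such that: the sum is commutative and associative wherever defined, $a+0=a$, $a^\perp$ is the unique element with $a+a^\perp=1$ where $1:=0^\perp$, and $a+1$ defined implies $a=0$. The order is $a\le b$ iff $b=a+c$ for some $c$. An effect monoid is an effect algebra with an associative total multiplication $\cdot$ with unit $1$ which distributes over the partial sum on both sides. It is directed complete if every directed (upwards) subset has a supremum. $[0,1]_{C(X)}$ is the set of continuous functions $X\to[0,1]$, with $f+g$ defined iff $f+g\le 1$ pointwise, complement $1-f$, and pointwise multiplication. A Boolean algebra is an effect monoid with $x+y$ defined iff $x\wedge y=0$ (then equal to $x\vee y$), and product $x\wedge y$. The direct sum $\oplus$ is the Cartesian product with componentwise operations; $\cong$ denotes isomorphism of effect monoids. A compact Hausdorff space is extremally disconnected if the closure of every open set is open. *)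

theory Defs
  imports "HOL-Analysis.Analysis" "HOL-Algebra.Complete_Lattice" "HOL-Algebra.Ring"
begin

text \<open>
  The partial sum is the total operation \<open>\<oplus>\<close> of the library record \<open>ring\<close> together with its domain
  of definition \<open>orth\<close>; values of \<open>\<oplus>\<close> outside that domain are never used.
\<close>

record 'a effect_monoid = "'a ring" +
  orth :: "'a \<Rightarrow> 'a \<Rightarrow> bool" (infix \<open>\<sharp>\<index>\<close> 50)
  compl :: "'a \<Rightarrow> 'a"

locale effect_algebra =
  fixes E (structure)
  assumes zero_closed: "\<zero> \<in> carrier E"
    and compl_closed: "a \<in> carrier E \<Longrightarrow> compl E a \<in> carrier E"
    and sum_closed: "\<lbrakk>a \<in> carrier E; b \<in> carrier E; a \<sharp> b\<rbrakk> \<Longrightarrow> a \<oplus> b \<in> carrier E"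
    and sum_comm:
      "\<lbrakk>a \<in> carrier E; b \<in> carrier E; a \<sharp> b\<rbrakk> \<Longrightarrow> b \<sharp> a \<and> a \<oplus> b = b \<oplus> a"
    and sum_assoc:
      "\<lbrakk>a \<in> carrier E; b \<in> carrier E; c \<in> carrier E; a \<sharp> b; a \<oplus> b \<sharp> c\<rbrakk>
        \<Longrightarrow> b \<sharp> c \<and> a \<sharp> b \<oplus> c \<and> (a \<oplus> b) \<oplus> c = a \<oplus> (b \<oplus> c)"
    and sum_zero: "a \<in> carrier E \<Longrightarrow> a \<sharp> \<zero> \<and> a \<oplus> \<zero> = a"
    and one_eq: "\<one> = compl E \<zero>"
    and compl_unique:
      "\<lbrakk>a \<in> carrier E; b \<in> carrier E\<rbrakk> \<Longrightarrow> a \<sharp> b \<and> a \<oplus> b = \<one> \<longleftrightarrow> b = compl E a"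
    and orth_one: "\<lbrakk>a \<in> carrier E; a \<sharp> \<one>\<rbrakk> \<Longrightarrow> a = \<zero>"

locale effect_monoid = effect_algebra M + Group.monoid M for M (structure) +
  assumes distrib_left:
      "\<lbrakk>a \<in> carrier M; b \<in> carrier M; c \<in> carrier M; a \<sharp> b\<rbrakk>
        \<Longrightarrow> c \<otimes> a \<sharp> c \<otimes> b \<and> c \<otimes> (a \<oplus> b) = c \<otimes> a \<oplus> c \<otimes> b"
    and distrib_right:
      "\<lbrakk>a \<in> carrier M; b \<in> carrier M; c \<in> carrier M; a \<sharp> b\<rbrakk>
        \<Longrightarrow> a \<otimes> c \<sharp> b \<otimes> c \<and> (a \<oplus> b) \<otimes> c = a \<otimes> c \<oplus> b \<otimes> c"

definition ea_order :: "('a, 'm) effect_monoid_scheme \<Rightarrow> 'a gorder" where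
  "ea_order E = \<lparr>carrier = carrier E, eq = (=),
     le = (\<lambda>a b. \<exists>c \<in> carrier E. a \<sharp>\<^bsub>E\<^esub> c \<and> b = a \<oplus>\<^bsub>E\<^esub> c)\<rparr>"

definition directed_in :: "('a, 'l) gorder_scheme \<Rightarrow> 'a set \<Rightarrow> bool" where
  "directed_in L D \<longleftrightarrow> D \<subseteq> carrier L \<and> D \<noteq> {} \<and>
     (\<forall>a \<in> D. \<forall>b \<in> D. \<exists>c \<in> D. a \<sqsubseteq>\<^bsub>L\<^esub> c \<and> b \<sqsubseteq>\<^bsub>L\<^esub> c)"

locale directed_complete_effect_monoid = effect_monoid +
  assumes directed_sup:
    "directed_in (ea_order M) D \<Longrightarrow> \<exists>s. least (ea_order M) s (Upper (ea_order M) D)"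

definition em_iso ::
  "('a, 'm) effect_monoid_scheme \<Rightarrow> ('b, 'n) effect_monoid_scheme \<Rightarrow> ('a \<Rightarrow> 'b) set" where
  "em_iso M N = {h. bij_betw h (carrier M) (carrier N) \<and>
     h \<zero>\<^bsub>M\<^esub> = \<zero>\<^bsub>N\<^esub> \<and> h \<one>\<^bsub>M\<^esub> = \<one>\<^bsub>N\<^esub> \<and>
     (\<forall>a \<in> carrier M. h (compl M a) = compl N (h a)) \<and>
     (\<forall>a \<in> carrier M. \<forall>b \<in> carrier M.
        (a \<sharp>\<^bsub>M\<^esub> b \<longleftrightarrow> h a \<sharp>\<^bsub>N\<^esub> h b) \<and>
        (a \<sharp>\<^bsub>M\<^esub> b \<longrightarrow> h (a \<oplus>\<^bsub>M\<^esub> b) = h a \<oplus>\<^bsub>N\<^esub> h b) \<and>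
        h (a \<otimes>\<^bsub>M\<^esub> b) = h a \<otimes>\<^bsub>N\<^esub> h b)}"

definition em_isomorphic ::
  "('a, 'm) effect_monoid_scheme \<Rightarrow> ('b, 'n) effect_monoid_scheme \<Rightarrow> bool" (infix \<open>\<cong>\<^sub>E\<close> 50) where
  "M \<cong>\<^sub>E N \<longleftrightarrow> em_iso M N \<noteq> {}"

definition em_sum ::
  "('a, 'm) effect_monoid_scheme \<Rightarrow> ('b, 'n) effect_monoid_scheme \<Rightarrow> ('a \<times> 'b) effect_monoid"
  (infixr \<open>\<oplus>\<^sub>E\<close> 65) where
  "M \<oplus>\<^sub>E N = \<lparr>carrier = carrier M \<times> carrier N,
     mult = (\<lambda>(a, b) (c, d). (a \<otimes>\<^bsub>M\<^esub> c, b \<otimes>\<^bsub>N\<^esub> d)),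
     one = (\<one>\<^bsub>M\<^esub>, \<one>\<^bsub>N\<^esub>),
     zero = (\<zero>\<^bsub>M\<^esub>, \<zero>\<^bsub>N\<^esub>),
     add = (\<lambda>(a, b) (c, d). (a \<oplus>\<^bsub>M\<^esub> c, b \<oplus>\<^bsub>N\<^esub> d)),
     orth = (\<lambda>(a, b) (c, d). a \<sharp>\<^bsub>M\<^esub> c \<and> b \<sharp>\<^bsub>N\<^esub> d),
     compl = (\<lambda>(a, b). (compl M a, compl N b))\<rparr>"

definition extremally_disconnected_space :: "'x topology \<Rightarrow> bool" where
  "extremally_disconnected_space X \<longleftrightarrow> (\<forall>U. openin X U \<longrightarrow> openin X (X closure_of U))"

text \<open>
  Functions on a space are represented by their extensional representatives, so that
  equality in the carrier is equality on \<open>topspace X\<close>.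
\<close>

definition unit_cfun :: "'x topology \<Rightarrow> ('x \<Rightarrow> real) effect_monoid" where
  "unit_cfun X = \<lparr>carrier = {f \<in> topspace X \<rightarrow>\<^sub>E {0..1}. continuous_map X euclideanreal f},
     mult = (\<lambda>f g. \<lambda>x \<in> topspace X. f x * g x),
     one = (\<lambda>x \<in> topspace X. 1),
     zero = (\<lambda>x \<in> topspace X. 0),
     add = (\<lambda>f g. \<lambda>x \<in> topspace X. f x + g x),
     orth = (\<lambda>f g. \<forall>x \<in> topspace X. f x + g x \<le> 1),
     compl = (\<lambda>f. \<lambda>x \<in> topspace X. 1 - f x)\<rparr>"

definition is_complement :: "('a, 'l) gorder_scheme \<Rightarrow> 'a \<Rightarrow> 'a \<Rightarrow> bool" where
  "is_complement L x y \<longleftrightarrow> y \<in> carrier L \<and>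
     x \<sqinter>\<^bsub>L\<^esub> y = \<bottom>\<^bsub>L\<^esub> \<and> x \<squnion>\<^bsub>L\<^esub> y = \<top>\<^bsub>L\<^esub>"

text \<open>The one-element Boolean algebra is allowed.\<close>

locale boolean_lattice = bounded_lattice +
  assumes meet_join_distrib:
      "\<lbrakk>x \<in> carrier L; y \<in> carrier L; z \<in> carrier L\<rbrakk>
        \<Longrightarrow> x \<sqinter> (y \<squnion> z) = (x \<sqinter> y) \<squnion> (x \<sqinter> z)"
    and complement_exists: "x \<in> carrier L \<Longrightarrow> \<exists>y. is_complement L x y"

locale complete_boolean_lattice = boolean_lattice + complete_lattice

definition boolean_em :: "('a, 'l) gorder_scheme \<Rightarrow> 'a effect_monoid" where
  "boolean_em L = \<lparr>carrier = carrier L,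
     mult = (\<lambda>x y. x \<sqinter>\<^bsub>L\<^esub> y),
     one = \<top>\<^bsub>L\<^esub>,
     zero = \<bottom>\<^bsub>L\<^esub>,
     add = (\<lambda>x y. x \<squnion>\<^bsub>L\<^esub> y),
     orth = (\<lambda>x y. x \<sqinter>\<^bsub>L\<^esub> y = \<bottom>\<^bsub>L\<^esub>),
     compl = (\<lambda>x. THE y. is_complement L x y)\<rparr>"

end

theory Submission
  imports Defs
begin

text \<open>
  Comparability: if \<open>s\<close> is maximal below both \<open>a = s \<oplus> u\<close>
    and \<open>b = s \<oplus> w\<close>, then \<open>u \<otimes> w = \<zero>\<close>, because
  \<open>s \<oplus> u \<otimes> w\<close> is again a common lower bound; a minimal \<open>f \<preceq> w\<^sup>\<bottom>\<close> with \<open>u \<otimes> f = u\<close> is an idempotent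
  that separates \<open>u\<close> from \<open>w\<close>, since \<open>f \<otimes> f\<close> has the same property. Hence the unit splits into two
  idempotents on which \<open>a\<close> and \<open>b\<close> are comparable.

  Splitting: let \<open>h\<close> be maximal such that \<open>h \<oplus> h\<close> is defined. Maximality makes \<open>e = h \<oplus> h\<close> idempotent,
  and every element below \<open>e\<^sup>\<bottom>\<close> idempotent; the latter form the complete Boolean algebra.

  On the part below \<open>e\<close> the powers of \<open>h\<close> provide dyadic scalars. An ultrafilter \<open>x\<close> of idempotents
  containing \<open>e\<close> makes the order total, so every \<open>a\<close> has a value at \<open>x\<close>, the supremum of the
  scalars below \<open>a\<close> modulo \<open>x\<close>. These values reflect the order,
    and a continuous function \<open>f\<close> is the
  value function of the supremum of all elements with values below \<open>f\<close>.
\<close>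

section \<open>Effect algebras\<close>

text \<open>Only directed suprema are given: there are no binary meets, the product is not assumed
  commutative, and nothing is assumed about products and suprema together. Idempotents make up for
  this. They are central, they form a Boolean algebra, and an inequality that holds on
  \<open>p\<close> and on \<open>neg p\<close> holds outright, so arguments can be made piecewise.
  The scalars are dyadic because halving is the only division that \<open>h\<close> provides. A real
  value is a supremum of such scalars and may forget an infinitesimal difference; completeness
  enters a second time, through the Archimedean property, to exclude such differences. Ultrafilters
  are taken among all idempotents of \<open>M\<close>, so the same device that yields the points of
  the space also decides identities in the Boolean part. Commutativity of \<open>M\<close> is never
  proved directly; it can be read off from the isomorphism.\<close>

context effect_algebra
begin

definition perp :: "'a \<Rightarrow> 'a \<Rightarrow> bool" (infix \<open>\<diamond>\<close> 50)
  where "a \<diamond> b \<longleftrightarrow> a \<in> carrier E \<and> b \<in> carrier E \<and> a \<sharp> b"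

definition leq :: "'a \<Rightarrow> 'a \<Rightarrow> bool" (infix \<open>\<preceq>\<close> 50)
  where "a \<preceq> b \<longleftrightarrow> (\<exists>c. a \<diamond> c \<and> b = a \<oplus> c)"

abbreviation neg :: "'a \<Rightarrow> 'a" where "neg \<equiv> compl E"

lemma perpD:
  assumes "a \<diamond> b" shows "a \<in> carrier E" "b \<in> carrier E" "a \<oplus> b \<in> carrier E"
  using assms sum_closed[of a b] by (auto simp: perp_def)

lemma perp_sym: "a \<diamond> b \<Longrightarrow> b \<diamond> a"
  using sum_comm[of a b] by (auto simp: perp_def)

lemma perp_commute: "a \<diamond> b \<longleftrightarrow> b \<diamond> a"
  by (metis perp_sym)

lemma add_comm: "a \<diamond> b \<Longrightarrow> a \<oplus> b = b \<oplus> a"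
  using sum_comm[of a b] by (auto simp: perp_def)

lemma add_assoc: "\<lbrakk>a \<diamond> b; a \<oplus> b \<diamond> c\<rbrakk> \<Longrightarrow> b \<diamond> c \<and> a \<diamond> b \<oplus> c \<and> a \<oplus> b \<oplus> c = a \<oplus> (b \<oplus> c)"
  using sum_assoc[of a b c] sum_closed[of a b] sum_closed[of b c] by (auto simp: perp_def)

lemma add_assoc_rev: "\<lbrakk>b \<diamond> c; a \<diamond> b \<oplus> c\<rbrakk> \<Longrightarrow> a \<diamond> b \<and> a \<oplus> b \<diamond> c \<and> a \<oplus> b \<oplus> c = a \<oplus> (b \<oplus> c)"
  using add_assoc[of c b a] perp_sym add_comm by metis

lemma neg_closed [simp]: "a \<in> carrier E \<Longrightarrow> neg a \<in> carrier E"
  by (rule compl_closed)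

lemma zero_mem [simp]: "\<zero> \<in> carrier E"
  by (rule zero_closed)

lemma one_mem [simp]: "\<one> \<in> carrier E"
  by (simp add: one_eq)

lemma perp_neg: "a \<in> carrier E \<Longrightarrow> a \<diamond> neg a" "a \<in> carrier E \<Longrightarrow> a \<oplus> neg a = \<one>"
  using compl_unique[of a "neg a"] by (auto simp: perp_def)

lemma neg_unique: "a \<diamond> b \<Longrightarrow> a \<oplus> b = \<one> \<Longrightarrow> b = neg a"
  using compl_unique[of a b] by (auto simp: perp_def)

lemma neg_neg [simp]: "a \<in> carrier E \<Longrightarrow> neg (neg a) = a"
  by (metis add_comm neg_unique perp_neg perp_sym)

lemma perp_zero [simp]:
  assumes "a \<in> carrier E" shows "a \<diamond> \<zero>" "\<zero> \<diamond> a" "a \<oplus> \<zero> = a" "\<zero> \<oplus> a = a"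
proof -
  show "a \<diamond> \<zero>" "a \<oplus> \<zero> = a" using assms sum_zero by (auto simp: perp_def)
  then show "\<zero> \<diamond> a" "\<zero> \<oplus> a = a" using perp_sym add_comm by metis+
qed

lemma neg_zero [simp]: "neg \<zero> = \<one>" and neg_one [simp]: "neg \<one> = \<zero>"
  by (metis one_eq, metis one_eq neg_neg zero_mem)

text \<open>Complete \<open>a \<oplus> b\<close> to \<open>\<one>\<close> by \<open>d\<close>: then
  \<open>b\<close> and \<open>c\<close> both complete \<open>d \<oplus> a\<close> to
  \<open>\<one>\<close>, and complements are unique.\<close>

lemma cancel:
  assumes "a \<diamond> b" "a \<diamond> c" "a \<oplus> b = a \<oplus> c" shows "b = c"
proof -
  define d where "d = neg (a \<oplus> b)"
  have d: "a \<oplus> b \<diamond> d" "a \<oplus> b \<oplus> d = \<one>" "a \<oplus> c \<diamond> d" "a \<oplus> c \<oplus> d = \<one>"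
    using assms perp_neg perpD unfolding d_def by auto
  have b: "b \<diamond> d" "a \<diamond> b \<oplus> d" "a \<oplus> (b \<oplus> d) = \<one>"
    using add_assoc[of a b d] assms d by auto
  have c: "c \<diamond> d" "a \<diamond> c \<oplus> d" "a \<oplus> (c \<oplus> d) = \<one>"
    using add_assoc[of a c d] assms d by auto
  have *: "x = neg (d \<oplus> a)" if x: "x \<diamond> d" "a \<diamond> x \<oplus> d" "a \<oplus> (x \<oplus> d) = \<one>" for x
  proof -
    have "x \<oplus> d \<diamond> a" "x \<oplus> d \<oplus> a = \<one>"
      using x add_comm perp_commute by auto
    then have "x \<diamond> d \<oplus> a" "x \<oplus> (d \<oplus> a) = \<one>"
      using add_assoc[of x d a] x by auto
    then show ?thesis using neg_unique[of "d \<oplus> a" x] add_comm[of x "d \<oplus> a"] perp_commute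
      by auto
  qed
  show ?thesis using *[OF b] *[OF c] by simp
qed

lemma add_eq_zero:
  assumes "a \<diamond> b" "a \<oplus> b = \<zero>" shows "a = \<zero>" "b = \<zero>"
proof -
  have z: "b = \<zero>" if "a \<diamond> b" "a \<oplus> b = \<zero>" for a b
  proof -
    \<comment> \<open>\<open>\<zero> \<oplus> \<one>\<close> is defined, so reassociating
      \<open>(a \<oplus> b) \<oplus> \<one>\<close> makes \<open>b \<oplus> \<one>\<close>
      defined.\<close>
    have "b \<diamond> \<one>" using that add_assoc[of a b \<one>] by auto
    then show ?thesis using orth_one by (auto simp: perp_def)
  qed
  show "a = \<zero>" "b = \<zero>" using z[of a b] z[of b a] assms add_comm perp_commute by auto
qed

lemma leqD: assumes "a \<preceq> b" shows "a \<in> carrier E" "b \<in> carrier E"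
  using assms perpD by (auto simp: leq_def)

lemma leqE: assumes "a \<preceq> b" obtains c
  where "a \<diamond> c" "b = a \<oplus> c" "c \<in> carrier E"
  using assms perpD by (auto simp: leq_def)

lemma leq_addI: assumes "a \<diamond> b" shows "a \<preceq> a \<oplus> b" "b \<preceq> a \<oplus> b"
  using assms add_comm perp_commute by (auto simp: leq_def)

lemma leq_refl [simp]: "a \<in> carrier E \<Longrightarrow> a \<preceq> a"
  unfolding leq_def by (metis perp_zero(1,3))

lemma leq_trans [trans]: "a \<preceq> b \<Longrightarrow> b \<preceq> c \<Longrightarrow> a \<preceq> c"
  unfolding leq_def by (metis add_assoc)

lemma leq_antisym: 
  assumes "a \<preceq> b" "b \<preceq> a" shows "a = b"
proof -
  obtain c d where c: "a \<diamond> c" "b = a \<oplus> c" and d: "b \<diamond> d" "a = b \<oplus> d"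
    using assms unfolding leq_def by blast
  have "c \<diamond> d" "a \<diamond> c \<oplus> d" "a \<oplus> (c \<oplus> d) = a"
    using add_assoc[of a c d] c d by metis+
  then have "a \<oplus> (c \<oplus> d) = a \<oplus> \<zero>" using c perpD(1) by simp
  then have "c \<oplus> d = \<zero>"
    using cancel[of a "c \<oplus> d" \<zero>] \<open>a \<diamond> c \<oplus> d\<close> perpD(1)
    by simp
  then have "c = \<zero>" using add_eq_zero(1) \<open>c \<diamond> d\<close> by blast
  then show ?thesis using c perpD(1)[OF c(1)] by simp
qed

lemma zero_leq [simp]: "a \<in> carrier E \<Longrightarrow> \<zero> \<preceq> a"
  unfolding leq_def by (metis perp_zero(2,4))

lemma leq_one [simp]: "a \<in> carrier E \<Longrightarrow> a \<preceq> \<one>"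
  unfolding leq_def by (metis perp_neg)

lemma leq_zeroD: "a \<preceq> \<zero> \<Longrightarrow> a = \<zero>"
  using leqD leq_antisym zero_leq by blast

text \<open>If \<open>t\<close> completes \<open>a \<oplus> b\<close> to \<open>\<one>\<close>, then
  \<open>a \<oplus> t\<close> is the complement of \<open>b\<close>. Definedness of sums thereby
  becomes a statement about the order.\<close>

lemma perp_iff: "a \<diamond> b \<longleftrightarrow> b \<in> carrier E \<and> a \<preceq> neg b"
proof
  assume ab: "a \<diamond> b"
  let ?t = "neg (a \<oplus> b)"
  have "b \<oplus> a \<diamond> ?t" "b \<oplus> a \<oplus> ?t = \<one>" "b \<diamond> a"
    using ab perp_neg[of "a \<oplus> b"] perpD perp_sym add_comm by metis+
  then have "a \<diamond> ?t" "neg b = a \<oplus> ?t" using add_assoc neg_unique by metis+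
  then show "b \<in> carrier E \<and> a \<preceq> neg b" using ab perpD by (auto simp: leq_def)
next
  assume *: "b \<in> carrier E \<and> a \<preceq> neg b"
  then obtain c where "a \<diamond> c" "neg b = a \<oplus> c" by (auto simp: leq_def)
  then show "a \<diamond> b" using perp_neg(1)[of b] * add_assoc_rev perp_sym by metis
qed

lemma neg_leq: assumes "a \<preceq> b" shows "neg b \<preceq> neg a"
proof -
  have "a \<diamond> neg b" using assms perp_iff leqD by auto
  then show ?thesis using perp_sym perp_iff by blast
qed

lemma leq_neg_swap: "\<lbrakk>b \<in> carrier E; a \<preceq> neg b\<rbrakk> \<Longrightarrow> b \<preceq> neg a"
  using perp_iff perp_sym leqD by metis

lemma neg_leq_swap: "\<lbrakk>a \<in> carrier E; neg a \<preceq> b\<rbrakk> \<Longrightarrow> neg b \<preceq> a"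
  using neg_leq[of "neg a" b] by auto

lemma perp_mono: "\<lbrakk>a \<diamond> b; a' \<preceq> a; b' \<preceq> b\<rbrakk> \<Longrightarrow> a' \<diamond> b'"
  using perp_iff leq_trans neg_leq leqD by metis

lemma add_mono1: assumes "a \<diamond> b" "a' \<preceq> a"
  shows "a' \<oplus> b \<preceq> a \<oplus> b"
proof -
  obtain c where "a' \<diamond> c" "a = a' \<oplus> c" using assms by (auto simp: leq_def)
  then have "c \<oplus> a' \<diamond> b" "c \<diamond> a'" "c \<oplus> a' \<oplus> b = a \<oplus> b"
    using assms add_comm perp_sym by metis+
  then show ?thesis using add_assoc leq_addI(2) by metis
qed

lemma add_mono: assumes "a \<diamond> b" "a' \<preceq> a" "b' \<preceq> b"
  shows "a' \<oplus> b' \<preceq> a \<oplus> b"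
proof -
  have "a' \<oplus> b \<preceq> a \<oplus> b" using assms add_mono1 by blast
  moreover have "a' \<oplus> b' \<preceq> a' \<oplus> b"
    using assms add_mono1[of b a' b'] by (metis add_comm leqD(2) leq_refl perp_mono perp_sym)
  ultimately show ?thesis using leq_trans by blast
qed

lemma add_leq_cancel: assumes "a \<diamond> b" "a \<diamond> c" "a \<oplus> b \<preceq> a \<oplus> c"
  shows "b \<preceq> c"
proof -
  obtain d where "a \<oplus> b \<diamond> d" "a \<oplus> c = a \<oplus> b \<oplus> d"
    using assms by (auto simp: leq_def)
  then have "b \<diamond> d" "a \<diamond> b \<oplus> d" "a \<oplus> c = a \<oplus> (b \<oplus> d)"
    using add_assoc assms by metis+
  then show ?thesis using assms cancel leq_addI by metis
qed

text \<open>Interchange of the middle terms, where each regrouping must also deliver the definedness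
  of the new partial sums. It serves to make \<open>h \<oplus> k\<close> addable to itself once
  \<open>h \<oplus> h\<close> and \<open>k \<oplus> k\<close> are orthogonal.\<close>

lemma exchange:
  assumes "a \<diamond> b" "c \<diamond> d" "a \<oplus> b \<diamond> c \<oplus> d"
  shows "a \<diamond> c" "b \<diamond> d" "a \<oplus> c \<diamond> b \<oplus> d" "a \<oplus> b \<oplus> (c \<oplus> d) = a \<oplus> c \<oplus> (b \<oplus> d)"
proof -
  have 1: "b \<diamond> c \<oplus> d" "a \<diamond> b \<oplus> (c \<oplus> d)" "a \<oplus> b \<oplus> (c \<oplus> d) = a \<oplus> (b \<oplus> (c \<oplus> d))"
    using add_assoc[OF assms(1,3)] by auto
  have 2: "b \<diamond> c" "b \<oplus> c \<diamond> d" "b \<oplus> c \<oplus> d = b \<oplus> (c \<oplus> d)"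
    using add_assoc_rev[OF assms(2) 1(1)] by auto
  have 3: "c \<diamond> b" "c \<oplus> b \<diamond> d" "c \<oplus> b \<oplus> d = b \<oplus> (c \<oplus> d)"
    using 2 perp_sym add_comm by metis+
  have 4: "b \<diamond> d" "c \<diamond> b \<oplus> d" "c \<oplus> (b \<oplus> d) = b \<oplus> (c \<oplus> d)"
    using add_assoc[OF 3(1,2)] 3 by auto
  have 5: "a \<diamond> c" "a \<oplus> c \<diamond> b \<oplus> d" "a \<oplus> c \<oplus> (b \<oplus> d) = a \<oplus> (c \<oplus> (b \<oplus> d))"
    using add_assoc_rev[OF 4(2), of a] 1 4 by auto
  show "a \<diamond> c" "b \<diamond> d" "a \<oplus> c \<diamond> b \<oplus> d" "a \<oplus> b \<oplus> (c \<oplus> d) = a \<oplus> c \<oplus> (b \<oplus> d)"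
    using 1 4 5 by auto
qed

section \<open>Suprema, infima and directed sets in the derived order\<close>

definition is_sup :: "'a set \<Rightarrow> 'a \<Rightarrow> bool" where
  "is_sup D s \<longleftrightarrow> s \<in> carrier E \<and> (\<forall>d\<in>D. d \<preceq> s) \<and> (\<forall>u\<in>carrier E. (\<forall>d\<in>D. d \<preceq> u) \<longrightarrow> s \<preceq> u)"

definition is_inf :: "'a set \<Rightarrow> 'a \<Rightarrow> bool" where
  "is_inf D s \<longleftrightarrow> s \<in> carrier E \<and> (\<forall>d\<in>D. s \<preceq> d) \<and> (\<forall>u\<in>carrier E. (\<forall>d\<in>D. u \<preceq> d) \<longrightarrow> u \<preceq> s)"

definition up_directed :: "'a set \<Rightarrow> bool" where
  "up_directed D \<longleftrightarrow> D \<subseteq> carrier E \<and> D \<noteq> {} \<and> (\<forall>a\<in>D. \<forall>b\<in>D. \<exists>c\<in>D. a \<preceq> c \<and> b \<preceq> c)"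

definition down_directed :: "'a set \<Rightarrow> bool" where
  "down_directed D \<longleftrightarrow> D \<subseteq> carrier E \<and> D \<noteq> {} \<and> (\<forall>a\<in>D. \<forall>b\<in>D. \<exists>c\<in>D. c \<preceq> a \<and> c \<preceq> b)"

lemma is_sup_upper: "is_sup D s \<Longrightarrow> d \<in> D \<Longrightarrow> d \<preceq> s"
  and is_sup_least: "is_sup D s \<Longrightarrow> u \<in> carrier E \<Longrightarrow> (\<And>d. d \<in> D \<Longrightarrow> d \<preceq> u) \<Longrightarrow> s \<preceq> u"
  and is_sup_closed: "is_sup D s \<Longrightarrow> s \<in> carrier E"
  by (auto simp: is_sup_def)

lemma is_inf_lower: "is_inf D s \<Longrightarrow> d \<in> D \<Longrightarrow> s \<preceq> d"
  and is_inf_greatest: "is_inf D s \<Longrightarrow> u \<in> carrier E \<Longrightarrow> (\<And>d. d \<in> D \<Longrightarrow> u \<preceq> d) \<Longrightarrow> u \<preceq> s"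
  and is_inf_closed: "is_inf D s \<Longrightarrow> s \<in> carrier E"
  by (auto simp: is_inf_def)

lemma is_inf_neg: assumes "D \<subseteq> carrier E" "is_sup (neg ` D) s" shows "is_inf D (neg s)"
  unfolding is_inf_def
proof (intro conjI ballI impI)
  show "neg s \<in> carrier E" using assms is_sup_closed by simp
  show "neg s \<preceq> d" if "d \<in> D" for d
    using neg_leq_swap[of d s] that assms is_sup_upper[OF assms(2), of "neg d"] by auto
  show "u \<preceq> neg s" if u: "u \<in> carrier E" "\<forall>d\<in>D. u \<preceq> d" for u
    using is_sup_least[OF assms(2), of "neg u"] u by (auto intro: leq_neg_swap neg_leq)
qed

end


section \<open>Idempotents, comparability and the halvable part\<close>

context effect_monoid
begin

notation perp (infix \<open>\<diamond>\<close> 50)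
notation leq (infix \<open>\<preceq>\<close> 50)

lemma mult_add:
  assumes "a \<diamond> b" "c \<in> carrier M"
  shows "c \<otimes> a \<diamond> c \<otimes> b" "c \<otimes> (a \<oplus> b) = c \<otimes> a \<oplus> c \<otimes> b"
    "a \<otimes> c \<diamond> b \<otimes> c" "(a \<oplus> b) \<otimes> c = a \<otimes> c \<oplus> b \<otimes> c"
  using assms distrib_left[of a b c] distrib_right[of a b c] by (auto simp: perp_def)

lemma mult_zero [simp]:
  assumes "a \<in> carrier M" shows "a \<otimes> \<zero> = \<zero>" "\<zero> \<otimes> a = \<zero>"
proof -
  have "a \<otimes> \<zero> \<diamond> a \<otimes> \<zero>" "a \<otimes> \<zero> \<oplus> a \<otimes> \<zero> = a \<otimes> \<zero> \<oplus> \<zero>"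
    "\<zero> \<otimes> a \<diamond> \<zero> \<otimes> a" "\<zero> \<otimes> a \<oplus> \<zero> \<otimes> a = \<zero> \<otimes> a \<oplus> \<zero>"
    using mult_add[of \<zero> \<zero> a] assms by auto
  then show "a \<otimes> \<zero> = \<zero>" "\<zero> \<otimes> a = \<zero>"
    using cancel[of "a \<otimes> \<zero>" "a \<otimes> \<zero>" \<zero>] cancel[of "\<zero> \<otimes> a" "\<zero> \<otimes> a" \<zero>] assms
    by auto
qed

lemma mult_mono1:
  assumes "a \<preceq> b" "c \<in> carrier M"
  shows "c \<otimes> a \<preceq> c \<otimes> b" "a \<otimes> c \<preceq> b \<otimes> c"
proof -
  obtain d where d: "a \<diamond> d" "b = a \<oplus> d" using leqE[OF assms(1)] by blast
  show "c \<otimes> a \<preceq> c \<otimes> b" "a \<otimes> c \<preceq> b \<otimes> c"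
    unfolding d(2) using mult_add[OF d(1) assms(2)] leq_addI by auto
qed

lemma mult_mono:
  assumes "a \<preceq> b" "c \<preceq> d" shows "a \<otimes> c \<preceq> b \<otimes> d"
  using mult_mono1(2)[of a b c] mult_mono1(1)[of c d b] assms leqD leq_trans by metis

lemma mult_leq:
  assumes "a \<in> carrier M" "b \<in> carrier M"
  shows "a \<otimes> b \<preceq> a" "a \<otimes> b \<preceq> b"
  using mult_mono1(1)[of b \<one> a] mult_mono1(2)[of a \<one> b] assms by auto

lemma mult_split:
  assumes "a \<in> carrier M" "p \<in> carrier M"
  shows "p \<otimes> a \<diamond> neg p \<otimes> a" "p \<otimes> a \<oplus> neg p \<otimes> a = a"
    "a \<otimes> p \<diamond> a \<otimes> neg p" "a \<otimes> p \<oplus> a \<otimes> neg p = a"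
  using mult_add[of p "neg p" a] perp_neg[of p] assms by auto

section \<open>Central idempotents and their Boolean operations\<close>

definition idem :: "'a \<Rightarrow> bool"
  where "idem p \<longleftrightarrow> p \<in> carrier M \<and> p \<otimes> p = p"

lemma idem_closed: "idem p \<Longrightarrow> p \<in> carrier M"
  by (simp add: idem_def)

lemma idem_zero [simp]: "idem \<zero>" and idem_one [simp]: "idem \<one>"
  by (simp_all add: idem_def)

lemma add_eq_selfD: "a \<diamond> b \<Longrightarrow> a \<oplus> b = a \<Longrightarrow> b = \<zero>"
  using cancel[of a b \<zero>] perpD(1)[of a b] by simp

lemma idem_mult_neg:
  assumes "idem p" shows "p \<otimes> neg p = \<zero>" "neg p \<otimes> p = \<zero>"
  using mult_split[of p p] add_eq_selfD[of p "p \<otimes> neg p"]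
    add_eq_selfD[of p "neg p \<otimes> p"] assms
  by (auto simp: idem_def)

lemma idemI: assumes "p \<in> carrier M" "p \<otimes> neg p = \<zero>" shows "idem p"
  using mult_split(4)[of p p] assms by (simp add: idem_def)

lemma idem_neg: assumes "idem p" shows "idem (neg p)"
  using idemI[of "neg p"] idem_mult_neg(2)[OF assms] idem_closed[OF assms] by simp

text \<open>The part of \<open>a\<close> outside \<open>p\<close> lies below
  \<open>neg p \<otimes> p = \<zero>\<close>, so splitting \<open>a\<close> along \<open>p\<close>
  on either side leaves a single term.\<close>

lemma leq_idem:
  assumes "idem p" "a \<preceq> p" shows "p \<otimes> a = a" "a \<otimes> p = a"
proof -
  have "neg p \<otimes> a \<preceq> \<zero>" "a \<otimes> neg p \<preceq> \<zero>"
    using mult_mono1[OF assms(2), of "neg p"] idem_mult_neg[OF assms(1)] assms(1) idem_closed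
    by auto
  then have "neg p \<otimes> a = \<zero>" "a \<otimes> neg p = \<zero>" by (auto intro: leq_zeroD)
  then show "p \<otimes> a = a" "a \<otimes> p = a"
    using mult_split[of a p] leqD[OF assms(2)] by auto
qed

text \<open>\<open>p \<otimes> a \<otimes> p\<close> equals \<open>p \<otimes> a\<close> and also
  \<open>a \<otimes> p\<close>, since both products lie below \<open>p\<close>, where
  \<open>p\<close> acts as a unit. This centrality stands in for commutativity of the
  product.\<close>

lemma idem_central:
  assumes "idem p" "a \<in> carrier M" shows "p \<otimes> a = a \<otimes> p"
proof -
  have p: "p \<in> carrier M" using assms idem_closed by simp
  have "(p \<otimes> a) \<otimes> p = p \<otimes> a" "p \<otimes> (a \<otimes> p) = a \<otimes> p"
    using leq_idem[OF assms(1)] mult_leq[OF p assms(2)] mult_leq[OF assms(2) p] by auto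
  then show ?thesis using p assms m_assoc by simp
qed

lemma idem_mult:
  assumes "idem p" "idem q" shows "idem (p \<otimes> q)"
proof -
  have c: "p \<in> carrier M" "q \<in> carrier M" using assms idem_closed by auto
  have "(p \<otimes> q) \<otimes> (p \<otimes> q) = p \<otimes> ((q \<otimes> p) \<otimes> q)"
    using c by (simp add: m_assoc)
  also have "\<dots> = p \<otimes> ((p \<otimes> q) \<otimes> q)"
    using idem_central[OF assms(1) c(2)] by simp
  also have "\<dots> = (p \<otimes> p) \<otimes> (q \<otimes> q)" using c by (simp add: m_assoc)
  finally show ?thesis using assms c by (simp add: idem_def)
qed

lemma idem_mult_mult:
  assumes "idem p" "a \<in> carrier M" "b \<in> carrier M"
  shows "p \<otimes> (a \<otimes> b) = (p \<otimes> a) \<otimes> (p \<otimes> b)"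
proof -
  have p: "p \<in> carrier M" using assms idem_closed by simp
  have "(p \<otimes> a) \<otimes> (p \<otimes> b) = p \<otimes> ((a \<otimes> p) \<otimes> b)"
    using p assms by (simp add: m_assoc)
  also have "\<dots> = p \<otimes> ((p \<otimes> a) \<otimes> b)"
    using idem_central[OF assms(1,2)] by simp
  also have "\<dots> = (p \<otimes> p) \<otimes> (a \<otimes> b)"
    using p assms by (simp add: m_assoc)
  finally show ?thesis using assms by (simp add: idem_def)
qed

lemma idem_glb: "\<lbrakk>idem p; a \<preceq> p; a \<preceq> q\<rbrakk> \<Longrightarrow> a \<preceq> p \<otimes> q"
  using mult_mono1(1)[of a q p] leq_idem(1)[of p a] idem_closed by metis

definition idem_join :: "'a \<Rightarrow> 'a \<Rightarrow> 'a"
  where "idem_join p q = neg (neg p \<otimes> neg q)"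

lemma idem_join_closed: "p \<in> carrier M \<Longrightarrow> q \<in> carrier M \<Longrightarrow> idem_join p q \<in> carrier M"
  by (simp add: idem_join_def)

lemma idem_idem_join: "idem p \<Longrightarrow> idem q \<Longrightarrow> idem (idem_join p q)"
  by (simp add: idem_join_def idem_mult idem_neg)

lemma leq_idem_join:
  assumes "p \<in> carrier M" "q \<in> carrier M"
  shows "p \<preceq> idem_join p q" "q \<preceq> idem_join p q"
  using leq_neg_swap[of p "neg p \<otimes> neg q"] leq_neg_swap[of q "neg p \<otimes> neg q"]
    mult_leq[of "neg p" "neg q"] assms by (auto simp: idem_join_def)

lemma idem_join_least:
  assumes "idem a" "p \<preceq> a" "q \<preceq> a" shows "idem_join p q \<preceq> a"
proof -
  have "neg a \<preceq> neg p \<otimes> neg q"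
    using mult_mono[of "neg a" "neg p" "neg a" "neg q"] neg_leq assms idem_neg[OF assms(1)]
    by (simp add: idem_def)
  then show ?thesis using neg_leq_swap[of a "neg p \<otimes> neg q"] assms idem_closed
    by (simp add: idem_join_def)
qed

text \<open>Multiplication by the join fixes both summands, hence their sum, which therefore lies
  below the join. Conversely the sum is idempotent because the cross terms vanish, and it is an
  upper bound.\<close>

lemma idem_orth_add:
  assumes "idem p" "idem q" "p \<otimes> q = \<zero>"
  shows "p \<diamond> q" "p \<oplus> q = idem_join p q"
proof -
  have c: "p \<in> carrier M" "q \<in> carrier M" using assms idem_closed by auto
  have "q = neg p \<otimes> q" using mult_split(2)[of q p] c assms(3) by simp
  then have *: "q \<preceq> neg p" using mult_leq(1)[of "neg p" q] c by simp
  then have 1: "q \<diamond> p" using perp_iff c by blast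
  then show 2: "p \<diamond> q" by (rule perp_sym)
  show "p \<oplus> q = idem_join p q"
  proof (rule leq_antisym)
    have "p \<otimes> idem_join p q = p" "q \<otimes> idem_join p q = q"
      using leq_idem(2)[OF idem_idem_join leq_idem_join(1)] leq_idem(2)[OF idem_idem_join leq_idem_join(2)] assms c
      by auto
    then have "p \<oplus> q = (p \<oplus> q) \<otimes> idem_join p q"
      using mult_add(4)[OF 2, of "idem_join p q"] c idem_join_closed by simp
    then show "p \<oplus> q \<preceq> idem_join p q"
      using mult_leq(2)[of "p \<oplus> q" "idem_join p q"] perpD[OF 2] c idem_join_closed by simp
    have "(p \<oplus> q) \<otimes> (p \<oplus> q) = (p \<oplus> q) \<otimes> p \<oplus> (p \<oplus> q) \<otimes> q"
      using mult_add[OF 2] perpD[OF 2] by simp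
    also have "\<dots> = p \<oplus> q"
      using mult_add[OF 2] assms c idem_central[OF assms(1) c(2)] by (simp add: idem_def)
    finally have "idem (p \<oplus> q)" using perpD[OF 2] by (simp add: idem_def)
    then show "idem_join p q \<preceq> p \<oplus> q" using idem_join_least leq_addI[OF 2] by simp
  qed
qed

end

section \<open>Zorn arguments and continuity of products along directed infima\<close>

context directed_complete_effect_monoid
begin

notation perp (infix \<open>\<diamond>\<close> 50)
notation leq (infix \<open>\<preceq>\<close> 50)

lemma directed_sup_exists:
  assumes "up_directed D" shows "\<exists>s. is_sup D s"
proof -
  have le: "le (ea_order M) a b \<longleftrightarrow> a \<preceq> b" if "a \<in> carrier M" for a b
    using that by (auto simp: ea_order_def leq_def perp_def)
  have c: "carrier (ea_order M) = carrier M" by (simp add: ea_order_def)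
  have "directed_in (ea_order M) D"
    using assms unfolding directed_in_def up_directed_def c by (meson le subsetD)
  from directed_sup[OF this] obtain s where s: "least (ea_order M) s (Upper (ea_order M) D)"
    by blast
  have D: "D \<subseteq> carrier M" using assms by (simp add: up_directed_def)
  have "is_sup D s"
    using s D unfolding least_def Upper_def is_sup_def c by (auto simp: le subset_iff)
  then show ?thesis by blast
qed

lemma directed_inf_exists:
  assumes "down_directed D" shows "\<exists>s. is_inf D s"
proof -
  have D: "D \<subseteq> carrier M" "D \<noteq> {}" "\<And>a b. a \<in> D \<Longrightarrow> b \<in> D \<Longrightarrow> \<exists>c\<in>D. c \<preceq> a \<and> c \<preceq> b"
    using assms unfolding down_directed_def by blast+
  have "\<exists>z\<in>neg ` D. neg a \<preceq> z \<and> neg b \<preceq> z" if "a \<in> D" "b \<in> D" for a b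
    using D(3)[OF that] neg_leq by blast
  then have "up_directed (neg ` D)"
    unfolding up_directed_def using D(1,2) by auto
  then show ?thesis
    using directed_sup_exists is_inf_neg assms unfolding down_directed_def by blast
qed

text \<open>A nonempty chain is directed, so closure under directed suprema bounds it inside
  \<open>S\<close>; the empty chain is bounded because \<open>S\<close> is nonempty.\<close>

lemma maximal_exists:
  assumes "S \<subseteq> carrier M" "S \<noteq> {}"
    and "\<And>D s. \<lbrakk>D \<subseteq> S; up_directed D; is_sup D s\<rbrakk> \<Longrightarrow> s \<in> S"
  shows "\<exists>m\<in>S. \<forall>a\<in>S. m \<preceq> a \<longrightarrow> a = m"
proof (rule predicate_Zorn)
  show "partial_order_on S (relation_of (\<preceq>) S)"
    using assms(1) leq_refl leq_trans leq_antisym by (intro partial_order_on_relation_ofI) blast+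
  fix C assume C: "C \<in> Chains (relation_of (\<preceq>) S)"
  then have sub: "C \<subseteq> S"
    and ch: "\<And>a b. a \<in> C \<Longrightarrow> b \<in> C \<Longrightarrow> a \<preceq> b \<or> b \<preceq> a"
    by (auto simp: Chains_def relation_of_def)
  show "\<exists>u\<in>S. \<forall>a\<in>C. a \<preceq> u"
  proof (cases "C = {}")
    case False
    then have "up_directed C" unfolding up_directed_def
      using sub ch assms(1) leq_refl by (meson subsetD subset_trans)
    then show ?thesis using directed_sup_exists assms(3) sub is_sup_upper by meson
  qed (use assms in auto)
qed

lemma minimal_exists:
  assumes "S \<subseteq> carrier M" "S \<noteq> {}"
    and "\<And>D s. \<lbrakk>D \<subseteq> S; down_directed D; is_inf D s\<rbrakk> \<Longrightarrow> s \<in> S"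
  shows "\<exists>m\<in>S. \<forall>a\<in>S. a \<preceq> m \<longrightarrow> a = m"
proof (rule predicate_Zorn[where P = "\<lambda>a b. b \<preceq> a"])
  show "partial_order_on S (relation_of (\<lambda>a b. b \<preceq> a) S)"
    using assms(1) leq_refl leq_trans leq_antisym by (intro partial_order_on_relation_ofI) blast+
  fix C assume C: "C \<in> Chains (relation_of (\<lambda>a b. b \<preceq> a) S)"
  then have sub: "C \<subseteq> S"
    and ch: "\<And>a b. a \<in> C \<Longrightarrow> b \<in> C \<Longrightarrow> a \<preceq> b \<or> b \<preceq> a"
    by (auto simp: Chains_def relation_of_def)
  show "\<exists>u\<in>S. \<forall>a\<in>C. u \<preceq> a"
  proof (cases "C = {}")
    case False
    then have "down_directed C" unfolding down_directed_def
      using sub ch assms(1) leq_refl by (meson subsetD subset_trans)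
    then show ?thesis using directed_inf_exists assms(3) sub is_inf_lower by meson
  qed (use assms in auto)
qed

text \<open>
  Normality needs no axiom: if \<open>t = f s \<oplus> w\<close> is the infimum of \<open>f ` D\<close>
    and \<open>d = s \<oplus> y\<close>, then
  \<open>w \<preceq> f y \<preceq> y\<close>, so \<open>s \<oplus> w\<close> is still a lower bound of \<open>D\<close>.
\<close>

lemma additive_inf:
  assumes D: "down_directed D" "is_inf D s"
    and add: "\<And>a b. a \<diamond> b \<Longrightarrow> f a \<diamond> f b \<and> f (a \<oplus> b) = f a \<oplus> f b"
    and defl: "\<And>a. a \<in> carrier M \<Longrightarrow> f a \<preceq> a"
  shows "is_inf (f ` D) (f s)"
proof -
  have s: "s \<in> carrier M" using D is_inf_closed by blast
  have sub: "D \<subseteq> carrier M" using D by (simp add: down_directed_def)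
  have mono: "f a \<preceq> f b" if "a \<preceq> b" for a b
    using that add leq_addI(1) by (metis leqE)
  have "down_directed (f ` D)"
    unfolding down_directed_def
  proof (intro conjI ballI)
    show "f ` D \<subseteq> carrier M" using sub defl leqD(1) by blast
    show "f ` D \<noteq> {}" using D by (simp add: down_directed_def)
    fix x y assume "x \<in> f ` D" "y \<in> f ` D"
    then obtain a b where ab: "a \<in> D" "b \<in> D" "x = f a" "y = f b" by blast
    then obtain c where "c \<in> D" "c \<preceq> a" "c \<preceq> b"
      using D(1) unfolding down_directed_def by blast
    then show "\<exists>z\<in>f ` D. z \<preceq> x \<and> z \<preceq> y" using mono ab by blast
  qed
  then obtain t where t: "is_inf (f ` D) t" using directed_inf_exists by blast
  have "f s \<preceq> t"
    using is_inf_greatest[OF t, of "f s"] mono is_inf_lower[OF D(2)] leqD(1) defl s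
    by (auto simp: leqD(1)[OF defl])
  then obtain w where w: "f s \<diamond> w" "t = f s \<oplus> w" "w \<in> carrier M"
    using leqE by blast
  have sw: "s \<diamond> w \<and> s \<oplus> w \<preceq> d" if d: "d \<in> D" for d
  proof -
    obtain y where y: "s \<diamond> y" "d = s \<oplus> y" "y \<in> carrier M"
      using leqE[OF is_inf_lower[OF D(2) d]] by blast
    have "f s \<oplus> w \<preceq> f s \<oplus> f y"
      using is_inf_lower[OF t imageI[OF d]] w(2) add[OF y(1)] y(2) by simp
    then have "w \<preceq> f y" using add_leq_cancel w add[OF y(1)] by blast
    then have "w \<preceq> y" using defl[OF y(3)] leq_trans by blast
    then show ?thesis
      using perp_mono[OF y(1), of s w] add_mono[OF y(1), of s w] s y(2) by simp
  qed
  then have p: "s \<diamond> w" using D by (auto simp: down_directed_def)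
  have "s \<oplus> w \<preceq> s" using is_inf_greatest[OF D(2) perpD(3)[OF p]] sw by blast
  then have "s \<oplus> w = s" using leq_addI(1)[OF p] leq_antisym by blast
  then have "w = \<zero>" using add_eq_selfD p by blast
  then have "t = f s" using w perpD(1)[OF w(1)] by simp
  then show ?thesis using t by simp
qed

lemma mult_inf:
  assumes "down_directed D" "is_inf D s" "c \<in> carrier M"
  shows "is_inf ((\<lambda>d. c \<otimes> d) ` D) (c \<otimes> s)" "is_inf ((\<lambda>d. d \<otimes> c) ` D) (s \<otimes> c)"
  using additive_inf[OF assms(1,2), of "\<lambda>d. c \<otimes> d"]
    additive_inf[OF assms(1,2), of "\<lambda>d. d \<otimes> c"]
    mult_add[of _ _ c] mult_leq assms(3) by auto

text \<open>Left multiplication by \<open>u\<close> preserves the infimum, and the image of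
  \<open>D\<close> is the single element \<open>u\<close>.\<close>

lemma inf_fixed:
  assumes "down_directed D" "is_inf D s" "u \<in> carrier M" "\<And>d. d \<in> D \<Longrightarrow> u \<otimes> d = u"
  shows "u \<otimes> s = u"
proof -
  have "(\<lambda>d. u \<otimes> d) ` D = {u}" using assms by (auto simp: down_directed_def)
  then have "is_inf {u} (u \<otimes> s)" using mult_inf(1)[OF assms(1-3)] by simp
  then show ?thesis using is_inf_lower[of "{u}" _ u] is_inf_greatest[of "{u}" _ u] assms(3) leq_antisym
    by auto
qed

lemma inf_idem:
  assumes "down_directed D" "is_inf D s" "\<And>d. d \<in> D \<Longrightarrow> idem d"
  shows "idem s"
proof -
  have s: "s \<in> carrier M" using assms is_inf_closed by blast
  \<comment> \<open>\<open>s\<close> absorbs every member of \<open>D\<close>, hence also the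
    infimum of \<open>D\<close>, which is \<open>s\<close> itself.\<close>
  have "s \<otimes> d = s" if "d \<in> D" for d
    using leq_idem(2) is_inf_lower[OF assms(2) that] assms(3) that by blast
  then show ?thesis using inf_fixed[OF assms(1,2) s] s by (simp add: idem_def)
qed

section \<open>Comparability and the halvable part\<close>

lemma separation:
  assumes u: "u \<in> carrier M" "w \<in> carrier M" "u \<otimes> w = \<zero>"
  shows "\<exists>p. idem p \<and> p \<otimes> w = \<zero> \<and> neg p \<otimes> u = \<zero>"
proof -
  define S where "S = {f \<in> carrier M. u \<otimes> f = u \<and> f \<preceq> neg w}"
  have "\<exists>m\<in>S. \<forall>a\<in>S. a \<preceq> m \<longrightarrow> a = m"
  proof (rule minimal_exists)
    show "S \<subseteq> carrier M" by (auto simp: S_def)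
    \<comment> \<open>As \<open>u \<otimes> w = \<zero>\<close>, splitting \<open>u\<close> along
      \<open>w\<close> on the right leaves only \<open>u \<otimes> neg w\<close>.\<close>
    have "neg w \<in> S" using mult_split(4)[of u w] u by (simp add: S_def)
    then show "S \<noteq> {}" by blast
    fix D s assume D: "D \<subseteq> S" "down_directed D" "is_inf D s"
    then obtain d where d: "d \<in> D" by (auto simp: down_directed_def)
    have "s \<preceq> neg w" using is_inf_lower[OF D(3) d] d D(1) leq_trans unfolding S_def by blast
    moreover have "u \<otimes> s = u" using inf_fixed[OF D(2,3) u(1)] D(1) by (auto simp: S_def)
    ultimately show "s \<in> S" using is_inf_closed[OF D(3)] by (simp add: S_def)
  qed
  then obtain f where f: "f \<in> S" "\<And>a. a \<in> S \<Longrightarrow> a \<preceq> f \<Longrightarrow> a = f"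
    by blast
  then have fc: "f \<in> carrier M" "u \<otimes> f = u" "f \<preceq> neg w" by (auto simp: S_def)
  have "f \<otimes> f \<preceq> f" using mult_leq(1) fc by simp
  moreover have "u \<otimes> (f \<otimes> f) = u" using fc u by (simp add: m_assoc[symmetric])
  ultimately have "f \<otimes> f = f"
    using f(2)[of "f \<otimes> f"] fc leq_trans[of "f \<otimes> f" f "neg w"] by (simp add: S_def)
  then have i: "idem f" using fc by (simp add: idem_def)
  have "f \<otimes> w \<preceq> f \<otimes> neg f"
    using mult_mono1(1)[of w "neg f" f] leq_neg_swap[of w f] fc u by simp
  then have "f \<otimes> w = \<zero>" using idem_mult_neg[OF i] leq_zeroD by simp
  moreover have "u \<otimes> neg f = \<zero>"
    using mult_split[of u f] add_eq_selfD[of u "u \<otimes> neg f"] u fc by simp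
  then have "neg f \<otimes> u = \<zero>" using idem_central[OF idem_neg[OF i]] u by simp
  ultimately show ?thesis using i by blast
qed

lemma comparability:
  assumes a: "a \<in> carrier M" "b \<in> carrier M"
  shows "\<exists>p. idem p \<and> p \<otimes> b \<preceq> p \<otimes> a \<and> neg p \<otimes> a \<preceq> neg p \<otimes> b"
proof -
  define S where "S = {s. s \<preceq> a \<and> s \<preceq> b}"
  have "\<exists>m\<in>S. \<forall>a\<in>S. m \<preceq> a \<longrightarrow> a = m"
  proof (rule maximal_exists)
    show "S \<subseteq> carrier M" using leqD by (auto simp: S_def)
    have "\<zero> \<in> S" using a by (simp add: S_def)
    then show "S \<noteq> {}" by blast
    fix D s assume D: "D \<subseteq> S" "up_directed D" "is_sup D s"
    show "s \<in> S" using is_sup_least[OF D(3) a(1)] is_sup_least[OF D(3) a(2)] D(1)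
      by (auto simp: S_def)
  qed
  then obtain s where s: "s \<preceq> a" "s \<preceq> b" "\<And>t. t \<preceq> a \<Longrightarrow> t \<preceq> b \<Longrightarrow> s \<preceq> t \<Longrightarrow> t = s"
    by (auto simp: S_def)
  obtain u where u: "s \<diamond> u" "a = s \<oplus> u" "u \<in> carrier M"
    using leqE[OF s(1)] by blast
  obtain w where w: "s \<diamond> w" "b = s \<oplus> w" "w \<in> carrier M"
    using leqE[OF s(2)] by blast
  have dyadic_multiple: "s \<in> carrier M" using s leqD by blast
  have le: "u \<otimes> w \<preceq> u" "u \<otimes> w \<preceq> w" using mult_leq u w by auto
  have "s \<diamond> u \<otimes> w" "s \<oplus> u \<otimes> w \<preceq> a" "s \<oplus> u \<otimes> w \<preceq> b"
    using perp_mono[OF u(1) leq_refl le(1)] add_mono[OF u(1) leq_refl le(1)]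
      add_mono[OF w(1) leq_refl le(2)] dyadic_multiple u w by auto
  then have "u \<otimes> w = \<zero>"
    using s(3)[of "s \<oplus> u \<otimes> w"] leq_addI(1) add_eq_selfD by blast
  then obtain p where p: "idem p" "p \<otimes> w = \<zero>" "neg p \<otimes> u = \<zero>"
    using separation u w by blast
  have pc: "p \<in> carrier M" using p idem_closed by blast
  \<comment> \<open>On \<open>p\<close> the surplus \<open>w\<close> of \<open>b\<close> vanishes,
    so only the common part \<open>s\<close> of \<open>b\<close> remains there; on
    \<open>neg p\<close> the same happens to the surplus \<open>u\<close> of
    \<open>a\<close>.\<close>
  have "p \<otimes> b = p \<otimes> s" "neg p \<otimes> a = neg p \<otimes> s"
    using mult_add(2)[OF u(1), of "neg p"] mult_add(2)[OF w(1), of p] u w p pc dyadic_multiple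
    by auto
  then show ?thesis using p mult_mono1(1)[OF s(1), of p] mult_mono1(1)[OF s(2), of "neg p"] pc
    by auto
qed

text \<open>Self-orthogonality means \<open>s \<preceq> neg s\<close>. The supremum is taken in one
  argument at a time: any two members of \<open>D\<close> are orthogonal by directedness, so
  \<open>s \<preceq> neg d\<close>, hence \<open>d \<preceq> neg s\<close>, for every
  \<open>d\<close>.\<close>

lemma double_sup:
  assumes "up_directed D" "is_sup D s" "\<And>d. d \<in> D \<Longrightarrow> d \<diamond> d"
  shows "s \<diamond> s"
proof -
  have s: "s \<in> carrier M" using assms is_sup_closed by blast
  have D: "D \<subseteq> carrier M" using assms by (simp add: up_directed_def)
  have 1: "d \<preceq> neg d'" if d: "d \<in> D" "d' \<in> D" for d d'
  proof -
    obtain c where "c \<in> D" "d \<preceq> c" "d' \<preceq> c"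
      using assms(1) d unfolding up_directed_def by blast
    then have "d \<diamond> d'" using perp_mono assms(3) by blast
    then show ?thesis using perp_iff by blast
  qed
  have "s \<preceq> neg d" if "d \<in> D" for d
    using is_sup_least[OF assms(2), of "neg d"] 1 that D by auto
  then have "d \<preceq> neg s" if "d \<in> D" for d
    using leq_neg_swap[of d s] that D by auto
  then have "s \<preceq> neg s" using is_sup_least[OF assms(2), of "neg s"] s by auto
  then show ?thesis using perp_iff s by blast
qed

lemma halvable_part:
  "\<exists>h. h \<diamond> h \<and> idem (h \<oplus> h) \<and> (\<forall>a. a \<preceq> neg (h \<oplus> h) \<longrightarrow> idem a)"
proof -
  have "\<exists>m\<in>{h. h \<diamond> h}. \<forall>a\<in>{h. h \<diamond> h}. m \<preceq> a \<longrightarrow> a = m"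
  proof (rule maximal_exists)
    show "{h. h \<diamond> h} \<subseteq> carrier M" using perpD by blast
    show "{h. h \<diamond> h} \<noteq> {}" using perp_zero(1)[OF zero_mem] by blast
    show "s \<in> {h. h \<diamond> h}" if "D \<subseteq> {h. h \<diamond> h}" "up_directed D" "is_sup D s" for D s
      using double_sup that by blast
  qed
  then obtain h where h: "h \<diamond> h" "\<And>k. k \<diamond> k \<Longrightarrow> h \<preceq> k \<Longrightarrow> k = h"
    by blast
  define b where "b = h \<oplus> h"
  define v where "v = neg b"
  have c: "h \<in> carrier M" "b \<in> carrier M" "v \<in> carrier M"
    using perpD[OF h(1)] by (auto simp: b_def v_def)
  \<comment> \<open>If \<open>k \<oplus> k\<close> fits below \<open>v\<close>, it can be added to
    \<open>h \<oplus> h\<close>; regrouping makes \<open>h \<oplus> k\<close> self-orthogonal, and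
    maximality of \<open>h\<close> leaves only \<open>k = \<zero>\<close>.\<close>
  have nohalf: "k = \<zero>" if k: "k \<diamond> k" "k \<oplus> k \<preceq> v" for k
  proof -
    have "k \<oplus> k \<diamond> h \<oplus> h" using k perp_iff c unfolding v_def b_def by blast
    then have "h \<diamond> k" "h \<oplus> k \<diamond> h \<oplus> k"
      using exchange[OF h(1) k(1)] perp_sym by blast+
    then show ?thesis using h(2) leq_addI(1) add_eq_selfD by blast
  qed
  \<comment> \<open>The product with \<open>v\<close> of a self-orthogonal element doubles inside
    \<open>v\<close>, so \<open>v\<close> annihilates all such elements, among them
    \<open>h\<close>.\<close>
  have half0: "v \<otimes> k = \<zero>" if k: "k \<diamond> k" for k
  proof (rule nohalf)
    have kc: "k \<in> carrier M" "k \<oplus> k \<in> carrier M" using perpD[OF k] by auto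
    show "v \<otimes> k \<diamond> v \<otimes> k" using mult_add(1)[OF k c(3)] .
    show "v \<otimes> k \<oplus> v \<otimes> k \<preceq> v"
      using mult_add(2)[OF k c(3)] mult_leq(1)[OF c(3) kc(2)] by simp
  qed
  have "v \<otimes> b = \<zero>" using mult_add(2)[OF h(1) c(3)] half0[OF h(1)] by (simp add: b_def)
  then have iv: "idem v" using idemI[of v] c by (simp add: v_def)
  then have ib: "idem b" using idem_neg[of v] c by (simp add: v_def)
  have "idem a" if av: "a \<preceq> v" for a
  proof -
    have a: "a \<in> carrier M" using av leqD by blast
    \<comment> \<open>\<open>a \<oplus> neg a\<close> is defined, so on each piece the smaller of
      the two is self-orthogonal. Hence \<open>v\<close> annihilates
      \<open>p \<otimes> neg a\<close> and \<open>neg p \<otimes> a\<close>, which forces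
      \<open>a \<otimes> neg a = \<zero>\<close>.\<close>
    obtain p where p: "idem p" "p \<otimes> neg a \<preceq> p \<otimes> a" "neg p \<otimes> a \<preceq> neg p \<otimes> neg a"
      using comparability[of a "neg a"] a by auto
    have pc: "p \<in> carrier M" using p idem_closed by blast
    have 1: "p \<otimes> a \<diamond> p \<otimes> neg a" "neg p \<otimes> a \<diamond> neg p \<otimes> neg a"
      using mult_add(1)[OF perp_neg(1)[OF a], of p] mult_add(1)[OF perp_neg(1)[OF a], of "neg p"] pc
      by auto
    have "p \<otimes> neg a \<diamond> p \<otimes> neg a" "neg p \<otimes> a \<diamond> neg p \<otimes> a"
      using perp_mono[OF 1(1) p(2) leq_refl] perp_mono[OF 1(2) leq_refl p(3)] a pc by auto
    then have 0: "v \<otimes> (p \<otimes> neg a) = \<zero>" "v \<otimes> (neg p \<otimes> a) = \<zero>"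
      using half0 by auto
    have "neg p \<otimes> a \<preceq> v" using mult_leq(2)[of "neg p" a] pc a av leq_trans by simp
    then have "neg p \<otimes> a = \<zero>" using leq_idem(1)[OF iv] 0(2) by simp
    then have "p \<otimes> a = a" using mult_split(2)[of a p] a pc by simp
    then have "a \<otimes> p = a" using idem_central[OF p(1) a] by simp
    then have "a \<otimes> neg a = ((a \<otimes> v) \<otimes> p) \<otimes> neg a"
      using leq_idem(2)[OF iv av] by simp
    also have "\<dots> = a \<otimes> (v \<otimes> (p \<otimes> neg a))"
      using a pc c by (simp add: m_assoc)
    finally have "a \<otimes> neg a = \<zero>" using 0 a by simp
    then show ?thesis using idemI a by simp
  qed
  then show ?thesis using h(1) ib unfolding v_def b_def by blast
qed

end


section \<open>Dyadic scalars\<close>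

definition dyadic :: "real set" where
  "dyadic = {r. \<exists>n k. k \<le> 2 ^ n \<and> r = real k / 2 ^ n}"

lemma dyadicI: "k \<le> 2 ^ n \<Longrightarrow> real k / 2 ^ n \<in> dyadic"
  by (auto simp: dyadic_def)

lemma dyadic_common:
  assumes "r \<in> dyadic" "s \<in> dyadic"
  obtains n j k where "j \<le> 2 ^ n" "k \<le> 2 ^ n" "r = real j / 2 ^ n" "s = real k / 2 ^ n"
proof -
  obtain n j where r: "j \<le> 2 ^ n" "r = real j / 2 ^ n" using assms(1) by (auto simp: dyadic_def)
  obtain m k where s: "k \<le> 2 ^ m" "s = real k / 2 ^ m" using assms(2) by (auto simp: dyadic_def)
  have "2 ^ m * j \<le> 2 ^ (n + m)" "2 ^ n * k \<le> 2 ^ (n + m)"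
    using mult_le_mono2[OF r(1), of "2 ^ m"] mult_le_mono2[OF s(1), of "2 ^ n"]
    by (simp_all add: power_add mult.commute)
  moreover have "r = real (2 ^ m * j) / 2 ^ (n + m)" "s = real (2 ^ n * k) / 2 ^ (n + m)"
    by (simp_all add: r s power_add)
  ultimately show thesis using that by blast
qed

lemma dyadic_bounds:
  assumes "r \<in> dyadic" shows "0 \<le> r \<and> r \<le> 1"
proof -
  obtain n k where *: "k \<le> 2 ^ n" "r = real k / 2 ^ n" using assms by (auto simp: dyadic_def)
  then have "real k \<le> 2 ^ n" by (metis of_nat_le_iff of_nat_numeral of_nat_power)
  then show ?thesis using * by simp
qed

lemma dyadic_zero [simp]: "0 \<in> dyadic" and dyadic_one [simp]: "1 \<in> dyadic"
  using dyadicI[of 0 0] dyadicI[of 1 0] by simp_all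

lemma dyadic_add:
  assumes "r \<in> dyadic" "s \<in> dyadic" "r + s \<le> 1" shows "r + s \<in> dyadic"
proof -
  obtain n j k where *: "j \<le> 2 ^ n" "k \<le> 2 ^ n" "r = real j / 2 ^ n" "s = real k / 2 ^ n"
    by (rule dyadic_common[OF assms(1,2)])
  then have "real (j + k) / 2 ^ n \<le> 1" using assms(3) by (simp add: add_divide_distrib)
  then have "real (j + k) \<le> 2 ^ n" by simp
  then have "j + k \<le> 2 ^ n" by (metis of_nat_le_iff of_nat_numeral of_nat_power)
  then show ?thesis using dyadicI[of "j + k" n] * by (simp add: add_divide_distrib)
qed

lemma dyadic_diff:
  assumes "r \<in> dyadic" "s \<in> dyadic" "r \<le> s" shows "s - r \<in> dyadic"
proof -
  obtain n j k where *: "j \<le> 2 ^ n" "k \<le> 2 ^ n" "r = real j / 2 ^ n" "s = real k / 2 ^ n"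
    by (rule dyadic_common[OF assms(1,2)])
  then have "j \<le> k" using assms(3) by (simp add: divide_le_cancel)
  then show ?thesis using dyadicI[of "k - j" n] * by (simp add: diff_divide_distrib)
qed

lemma dyadic_mult:
  assumes "r \<in> dyadic" "s \<in> dyadic" shows "r * s \<in> dyadic"
proof -
  obtain n j k where *: "j \<le> 2 ^ n" "k \<le> 2 ^ n" "r = real j / 2 ^ n" "s = real k / 2 ^ n"
    by (rule dyadic_common[OF assms(1,2)])
  then show ?thesis using dyadicI[of "j * k" "n + n"] mult_le_mono[OF *(1,2)]
    by (simp add: power_add)
qed

lemma dyadic_dense:
  fixes x y :: real
  assumes "0 \<le> x" "x < y" "y \<le> 1" obtains r where "r \<in> dyadic" "x < r" "r < y"
proof -
  obtain n where n: "(1 / 2) ^ n < y - x" using real_arch_pow_inv[of "y - x" "1 / 2"] assms by auto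
  \<comment> \<open>The first grid point strictly above \<open>x\<close>; it exceeds
    \<open>x\<close> by at most the mesh, which is smaller than \<open>y - x\<close>.\<close>
  define k where "k = nat \<lfloor>x * 2 ^ n\<rfloor> + 1"
  have "0 \<le> x * 2 ^ n" using assms by simp
  then have k: "x * 2 ^ n < real k" "real k \<le> x * 2 ^ n + 1" unfolding k_def by linarith+
  have 1: "x < real k / 2 ^ n" using k by (simp add: field_simps)
  have "real k / 2 ^ n \<le> x + (1 / 2) ^ n" using k by (simp add: field_simps)
  then have 2: "real k / 2 ^ n < y" using n by simp
  then have "real k / 2 ^ n \<le> 1" using assms(3) by linarith
  then have "real k \<le> 2 ^ n" by simp
  then have "k \<le> 2 ^ n" by (metis of_nat_le_iff of_nat_numeral of_nat_power)
  then show thesis using that dyadicI 1 2 by blast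
qed

section \<open>Dyadic multiples of \<open>e\<close> as scalars\<close>

locale halved_effect_monoid = directed_complete_effect_monoid +
  fixes h
  assumes h_perp: "effect_algebra.perp M h h"
    and h_idem: "effect_monoid.idem M (h \<oplus> h)"
begin

notation perp (infix \<open>\<diamond>\<close> 50)
notation leq (infix \<open>\<preceq>\<close> 50)

definition e :: 'a where "e = h \<oplus> h"

lemma e_idem: "idem e" using h_idem by (simp add: e_def)

lemma e_closed [simp]: "e \<in> carrier M" using e_idem idem_closed by simp

lemma h_closed [simp]: "h \<in> carrier M" using h_perp perpD by blast

lemma h_leq: "h \<preceq> e" using h_perp leq_addI by (simp add: e_def)

text \<open>The scalar \<open>1 / 2 ^ n\<close> of the part below \<open>e\<close>; the recursion
  starts at \<open>e\<close>, the unit of that part.\<close>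

primrec half_power :: "nat \<Rightarrow> 'a" where
  "half_power 0 = e"
| "half_power (Suc n) = h \<otimes> half_power n"

lemma half_power_closed [simp]: "half_power n \<in> carrier M"
  by (induction n) auto

lemma e_half_power: "e \<otimes> half_power n = half_power n"
proof (cases n)
  case (Suc m)
  then show ?thesis using leq_idem(1)[OF e_idem h_leq] by (simp add: m_assoc[symmetric])
qed (use e_idem in \<open>simp add: idem_def\<close>)

lemma half_power_half: "half_power (Suc n) \<diamond> half_power (Suc n)" "half_power (Suc n) \<oplus> half_power (Suc n) = half_power n"
  using mult_add(3,4)[OF h_perp, of "half_power n"] e_half_power[of n] by (simp_all add: e_def)

lemma half_power_mult: "half_power n \<otimes> half_power m = half_power (n + m)"
  by (induction n) (simp_all add: e_half_power m_assoc)

primrec multiple :: "nat \<Rightarrow> 'a \<Rightarrow> 'a" where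
  "multiple 0 a = \<zero>"
| "multiple (Suc k) a = multiple k a \<oplus> a"

text \<open>\<open>multiple\<close> is total while the sum is partial. This predicate keeps track of
  the existence of all intermediate sums through the inductions.\<close>

definition multiple_defined :: "nat \<Rightarrow> 'a \<Rightarrow> bool" where
  "multiple_defined k a \<longleftrightarrow> a \<in> carrier M \<and> (\<forall>j<k. multiple j a \<diamond> a)"

lemma multiple_defined_mono: "multiple_defined k a \<Longrightarrow> j \<le> k \<Longrightarrow> multiple_defined j a"
  by (auto simp: multiple_defined_def)

lemma multiple_defined_Suc: "multiple_defined (Suc k) a \<longleftrightarrow> multiple_defined k a \<and> multiple k a \<diamond> a"
  by (auto simp: multiple_defined_def less_Suc_eq)

lemma multiple_closed: "multiple_defined k a \<Longrightarrow> multiple k a \<in> carrier M"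
  by (cases k) (auto simp: multiple_defined_Suc dest: perpD)

lemma multiple_add: "multiple_defined (j + k) a \<Longrightarrow> multiple j a \<diamond> multiple k a \<and> multiple (j + k) a = multiple j a \<oplus> multiple k a"
proof (induction k)
  case 0
  then show ?case using multiple_closed by simp
next
  case (Suc k)
  then have 1: "multiple j a \<diamond> multiple k a" "multiple (j + k) a = multiple j a \<oplus> multiple k a" "multiple (j + k) a \<diamond> a"
    by (auto simp: multiple_defined_Suc)
  then show ?case using add_assoc[of "multiple j a" "multiple k a" a] by simp
qed

text \<open>Each summand \<open>a \<oplus> a\<close> is added in two halves, and reassociation shows
  that the intermediate sums exist. Iterated from \<open>half_power 0 = e\<close>, this makes
  \<open>2 ^ n\<close> copies of \<open>half_power n\<close> summable, and it also refines
  denominators.\<close>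

lemma multiple_half:
  assumes "a \<diamond> a" shows "multiple_defined k (a \<oplus> a) \<Longrightarrow> multiple_defined (2 * k) a \<and> multiple (2 * k) a = multiple k (a \<oplus> a)"
proof (induction k)
  case 0
  then show ?case using perpD[OF assms] by (simp add: multiple_defined_def)
next
  case (Suc k)
  then have 1: "multiple_defined (2 * k) a" "multiple (2 * k) a = multiple k (a \<oplus> a)" "multiple (2 * k) a \<diamond> a \<oplus> a"
    by (auto simp: multiple_defined_Suc)
  then have "multiple (2 * k) a \<diamond> a" "multiple (2 * k) a \<oplus> a \<diamond> a"
    "multiple (2 * k) a \<oplus> a \<oplus> a = multiple (2 * k) a \<oplus> (a \<oplus> a)"
    using add_assoc_rev[OF assms 1(3)] by auto
  then show ?case using 1 by (simp add: multiple_defined_Suc)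
qed

lemma multiple_mult:
  assumes "c \<in> carrier M" shows "multiple_defined k a \<Longrightarrow> multiple_defined k (c \<otimes> a) \<and> multiple k (c \<otimes> a) = c \<otimes> multiple k a"
proof (induction k)
  case 0
  then show ?case using assms by (simp add: multiple_defined_def)
next
  case (Suc k)
  then show ?case using mult_add[of "multiple k a" a c] assms by (simp add: multiple_defined_Suc)
qed

definition dyadic_multiple :: "nat \<Rightarrow> nat \<Rightarrow> 'a"
  where "dyadic_multiple n k = multiple k (half_power n)"

lemma multiple_defined_half_power: "k \<le> 2 ^ n \<Longrightarrow> multiple_defined k (half_power n)"
proof -
  have "multiple_defined (2 ^ n) (half_power n)"
  proof (induction n)
    case 0
    show ?case by (simp add: multiple_defined_def)
  next
    case (Suc n)
    then show ?case using multiple_half[OF half_power_half(1), of "2 ^ n" n]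
      by (simp only: half_power_half(2) power_Suc)
  qed
  then show "k \<le> 2 ^ n \<Longrightarrow> multiple_defined k (half_power n)"
    using multiple_defined_mono by blast
qed

lemma dyadic_multiple_closed: "k \<le> 2 ^ n \<Longrightarrow> dyadic_multiple n k \<in> carrier M"
  using multiple_closed multiple_defined_half_power by (simp add: dyadic_multiple_def)

lemma dyadic_multiple_add: "j + k \<le> 2 ^ n \<Longrightarrow> dyadic_multiple n j \<diamond> dyadic_multiple n k \<and> dyadic_multiple n (j + k) = dyadic_multiple n j \<oplus> dyadic_multiple n k"
  using multiple_add multiple_defined_half_power by (simp add: dyadic_multiple_def)

lemma dyadic_multiple_lift: "k \<le> 2 ^ n \<Longrightarrow> dyadic_multiple (n + m) (2 ^ m * k) = dyadic_multiple n k"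
proof (induction m)
  case (Suc m)
  have "2 ^ m * k \<le> 2 ^ (n + m)" using Suc.prems by (simp add: power_add)
  then have "multiple_defined (2 ^ m * k) (half_power (n + m))"
    using multiple_defined_half_power by blast
  then show ?case using multiple_half[OF half_power_half(1), of "2 ^ m * k" "n + m"] Suc
    unfolding dyadic_multiple_def half_power_half(2) by (simp add: mult.assoc)
qed simp

lemma half_power_dyadic_multiple: "k \<le> 2 ^ m \<Longrightarrow> half_power n \<otimes> dyadic_multiple m k = dyadic_multiple (n + m) k"
  using multiple_mult[of "half_power n" k "half_power m"] multiple_defined_half_power
  by (simp add: dyadic_multiple_def half_power_mult)

lemma dyadic_multiple_mult: "j \<le> 2 ^ n \<Longrightarrow> k \<le> 2 ^ m \<Longrightarrow> dyadic_multiple n j \<otimes> dyadic_multiple m k = dyadic_multiple (n + m) (j * k)"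
proof (induction j)
  case 0
  then show ?case using dyadic_multiple_closed by (simp add: dyadic_multiple_def[of _ 0])
next
  case (Suc j)
  have "dyadic_multiple n j \<diamond> half_power n"
    using multiple_defined_half_power[OF Suc.prems(1)]
    by (simp add: multiple_defined_Suc dyadic_multiple_def)
  then have "dyadic_multiple n (Suc j) \<otimes> dyadic_multiple m k = dyadic_multiple (n + m) (j * k) \<oplus> dyadic_multiple (n + m) k"
    using mult_add(4)[of "dyadic_multiple n j" "half_power n" "dyadic_multiple m k"] Suc half_power_dyadic_multiple dyadic_multiple_closed
    by (simp add: dyadic_multiple_def[of n "Suc j"] dyadic_multiple_def[of n j])
  moreover have "j * k + k \<le> 2 ^ (n + m)"
    using mult_le_mono[OF Suc.prems] by (simp add: power_add)
  ultimately show ?case using dyadic_multiple_add[of "j * k" k "n + m"] by (simp add: add.commute)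
qed

text \<open>Meaningful on dyadic arguments only.\<close>

definition scalar :: "real \<Rightarrow> 'a" where
  "scalar r = (SOME s. \<exists>n k. k \<le> 2 ^ n \<and> r = real k / 2 ^ n \<and> s = dyadic_multiple n k)"

text \<open>Two representations of the same real agree over the common denominator
  \<open>2 ^ (n + n')\<close>, so the choice in \<open>scalar\<close> does not matter.\<close>

lemma scalar_eq: assumes "k \<le> 2 ^ n" shows "scalar (real k / 2 ^ n) = dyadic_multiple n k"
  unfolding scalar_def
proof (rule some_equality)
  show "\<exists>n' k'. k' \<le> 2 ^ n' \<and> real k / 2 ^ n = real k' / 2 ^ n' \<and> dyadic_multiple n k = dyadic_multiple n' k'"
    using assms by blast
  fix s assume "\<exists>n' k'. k' \<le> 2 ^ n' \<and> real k / 2 ^ n = real k' / 2 ^ n' \<and> s = dyadic_multiple n' k'"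
  then obtain n' k' where *: "k' \<le> 2 ^ n'" "real k / 2 ^ n = real k' / 2 ^ n'" "s = dyadic_multiple n' k'"
    by blast
  then have "real (2 ^ n' * k) = real (2 ^ n * k')" by (simp add: field_simps)
  then have "2 ^ n' * k = 2 ^ n * k'" by (simp only: of_nat_eq_iff)
  then show "s = dyadic_multiple n k"
    using dyadic_multiple_lift[OF assms, of n'] dyadic_multiple_lift[OF *(1), of n] *(3)
    by (simp add: add.commute)
qed

lemma scalar_closed: "r \<in> dyadic \<Longrightarrow> scalar r \<in> carrier M"
  using scalar_eq dyadic_multiple_closed by (auto simp: dyadic_def)

lemma scalar_zero [simp]: "scalar 0 = \<zero>" and sg_one [simp]: "scalar 1 = e"
  using scalar_eq[of 0 0] scalar_eq[of 1 0] by (simp_all add: dyadic_multiple_def)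

lemma scalar_add:
  assumes "r \<in> dyadic" "s \<in> dyadic" "r + s \<le> 1"
  shows "scalar r \<diamond> scalar s" "scalar (r + s) = scalar r \<oplus> scalar s"
proof -
  obtain n j k where *: "j \<le> 2 ^ n" "k \<le> 2 ^ n" "r = real j / 2 ^ n" "s = real k / 2 ^ n"
    by (rule dyadic_common[OF assms(1,2)])
  then have "real (j + k) / 2 ^ n \<le> 1" using assms(3) by (simp add: add_divide_distrib)
  then have "real (j + k) \<le> 2 ^ n" by simp
  then have le: "j + k \<le> 2 ^ n" by (metis of_nat_le_iff of_nat_numeral of_nat_power)
  have "r + s = real (j + k) / 2 ^ n" by (simp add: * add_divide_distrib)
  then show "scalar r \<diamond> scalar s" "scalar (r + s) = scalar r \<oplus> scalar s"
    using dyadic_multiple_add[OF le] scalar_eq[OF le] scalar_eq[OF *(1)] scalar_eq[OF *(2)] *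
    by simp_all
qed

lemma scalar_mult:
  assumes "r \<in> dyadic" "s \<in> dyadic" shows "scalar (r * s) = scalar r \<otimes> scalar s"
proof -
  obtain n j k where *: "j \<le> 2 ^ n" "k \<le> 2 ^ n" "r = real j / 2 ^ n" "s = real k / 2 ^ n"
    by (rule dyadic_common[OF assms(1,2)])
  have "j * k \<le> 2 ^ (n + n)" using mult_le_mono[OF *(1,2)] by (simp add: power_add)
  then have "scalar (real (j * k) / 2 ^ (n + n)) = dyadic_multiple n j \<otimes> dyadic_multiple n k"
    using dyadic_multiple_mult[OF *(1,2)] scalar_eq[of "j * k" "n + n"] by metis
  moreover have "r * s = real (j * k) / 2 ^ (n + n)" by (simp add: * power_add)
  ultimately show ?thesis using scalar_eq[OF *(1)] scalar_eq[OF *(2)] *(3,4) by metis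
qed

lemma scalar_mono:
  assumes "r \<in> dyadic" "s \<in> dyadic" "r \<le> s" shows "scalar r \<preceq> scalar s"
  using scalar_add[of r "s - r"] leq_addI(1)[of "scalar r" "scalar (s - r)"] dyadic_diff[of r s] dyadic_bounds[of s] assms
  by simp

lemma scalar_leq_e: "r \<in> dyadic \<Longrightarrow> scalar r \<preceq> e"
  using scalar_mono[of r 1] dyadic_bounds by simp

text \<open>Both sides complete \<open>scalar r\<close> to \<open>e\<close>, and cancellation
  applies.\<close>

lemma e_neg_scalar:
  assumes "r \<in> dyadic" shows "e \<otimes> neg (scalar r) = scalar (1 - r)"
proof -
  have d: "1 - r \<in> dyadic" using dyadic_diff[of r 1] dyadic_bounds assms by simp
  have c: "scalar r \<in> carrier M" using scalar_closed assms by simp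
  have "e \<otimes> scalar r = scalar r" using leq_idem(1)[OF e_idem scalar_leq_e] assms by simp
  then have "scalar r \<diamond> e \<otimes> neg (scalar r)" "scalar r \<oplus> e \<otimes> neg (scalar r) = e"
    using mult_add(1,2)[OF perp_neg(1)[OF c] e_closed] perp_neg(2)[OF c] by simp_all
  then show ?thesis using scalar_add[OF assms d] cancel[of "scalar r" "e \<otimes> neg (scalar r)" "scalar (1 - r)"]
    by simp
qed

text \<open>A positive \<open>t\<close> dominates some \<open>1 / 2 ^ n\<close>, so \<open>p\<close>
  annihilates \<open>half_power n\<close>; doubling carries this up from
  \<open>half_power (Suc n)\<close> to \<open>half_power n\<close> and finally to
  \<open>e\<close>.\<close>

lemma mult_scalar_zeroD:
  assumes "t \<in> dyadic" "0 < t" "p \<in> carrier M" "p \<otimes> scalar t = \<zero>"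
  shows "p \<otimes> e = \<zero>"
proof -
  obtain n k where k: "k \<le> 2 ^ n" "t = real k / 2 ^ n" using assms by (auto simp: dyadic_def)
  then have "1 \<le> k" using assms(2) by (cases k) auto
  then have "real 1 / 2 ^ n \<le> t" "real 1 / 2 ^ n \<in> dyadic"
    using k dyadicI[of 1 n] by (auto simp: divide_simps)
  then have "scalar (real 1 / 2 ^ n) \<preceq> scalar t" using scalar_mono assms(1) by blast
  then have "half_power n \<preceq> scalar t"
    using scalar_eq[of 1 n] by (simp add: dyadic_multiple_def)
  then have 0: "p \<otimes> half_power n = \<zero>"
    using mult_mono1(1)[of "half_power n" "scalar t" p] assms leq_zeroD by simp
  have "p \<otimes> half_power n = \<zero> \<Longrightarrow> p \<otimes> e = \<zero>" for n
  proof (induction n)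
    case (Suc n)
    then show ?case using mult_add(2)[OF half_power_half(1)[of n] assms(3)] half_power_half(2)[of n]
      by (simp del: half_power.simps)
  qed simp
  then show ?thesis using 0 by blast
qed

text \<open>
  The Archimedean property: the infimum \<open>g\<close> of the \<open>half_power n\<close> satisfies \<open>g \<oplus> g \<preceq> g\<close>.
\<close>

lemma leq_half_power_zero:
  assumes "\<And>n. d \<preceq> half_power n" shows "d = \<zero>"
proof -
  have le: "half_power (n + m) \<preceq> half_power n" "half_power (n + m) \<preceq> half_power m" for n m
    using mult_leq[of "half_power n" "half_power m"] by (simp_all add: half_power_mult)
  have "down_directed (range half_power)"
    unfolding down_directed_def using le by (auto simp: subset_iff) blast
  then obtain g where g: "is_inf (range half_power) g" using directed_inf_exists by blast
  have 1: "g \<preceq> half_power n" for n using is_inf_lower[OF g] by blast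
  have gg: "g \<diamond> g" "g \<oplus> g \<preceq> half_power n" for n
    using perp_mono[OF half_power_half(1) 1 1] add_mono[OF half_power_half(1) 1 1] half_power_half(2)
    by auto
  have "g \<oplus> g \<preceq> g" using is_inf_greatest[OF g perpD(3)[OF gg(1)]] gg(2) by blast
  then have "g = \<zero>" using add_eq_selfD[OF gg(1)] leq_addI(1)[OF gg(1)] leq_antisym by blast
  moreover have "d \<preceq> g" using is_inf_greatest[OF g] assms leqD by blast
  ultimately show ?thesis using leq_zeroD by simp
qed

end


section \<open>Ultrafilters of idempotents and the values of an element\<close>

context effect_monoid
begin

text \<open>The ultrafilters of the Boolean algebra of idempotents. Upward closure is a consequence,
  derived in \<open>ultra_upward\<close>.\<close>

definition ultra :: "'a set \<Rightarrow> bool" where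
  "ultra x \<longleftrightarrow> x \<subseteq> Collect idem \<and> \<one> \<in> x \<and> \<zero> \<notin> x \<and> (\<forall>p\<in>x. \<forall>q\<in>x. p \<otimes> q \<in> x) \<and>
     (\<forall>p. idem p \<longrightarrow> p \<in> x \<or> neg p \<in> x)"

lemma ultraD:
  assumes "ultra x"
  shows "p \<in> x \<Longrightarrow> idem p" "p \<in> x \<Longrightarrow> p \<in> carrier M" "\<one> \<in> x" "\<zero> \<notin> x"
    "p \<in> x \<Longrightarrow> q \<in> x \<Longrightarrow> p \<otimes> q \<in> x" "idem p \<Longrightarrow> p \<in> x \<or> neg p \<in> x"
  using assms idem_closed unfolding ultra_def by blast+

lemma ultra_neg: assumes "ultra x" "idem p" shows "neg p \<in> x \<longleftrightarrow> p \<notin> x"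
  using ultraD(4)[OF assms(1)] ultraD(5)[OF assms(1), of p "neg p"] ultraD(6)[OF assms]
    idem_mult_neg(1)[OF assms(2)] by auto

lemma ultra_upward:
  assumes "ultra x" "p \<in> x" "p \<preceq> q" "idem q" shows "q \<in> x"
proof (rule ccontr)
  assume "q \<notin> x"
  then have "neg q \<in> x" using ultra_neg assms by blast
  moreover have "p \<otimes> neg q \<preceq> q \<otimes> neg q"
    using mult_mono1(2)[OF assms(3)] assms(4) idem_closed by simp
  then have "p \<otimes> neg q = \<zero>" using idem_mult_neg(1)[OF assms(4)] leq_zeroD by simp
  ultimately show False using ultraD(4,5)[OF assms(1)] assms(2) by metis
qed

lemma ultra_mult_iff:
  assumes "ultra x" "idem p" "idem q"
  shows "p \<otimes> q \<in> x \<longleftrightarrow> p \<in> x \<and> q \<in> x"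
  using ultra_upward[OF assms(1) _ mult_leq(1)[of p q] assms(2)]
    ultra_upward[OF assms(1) _ mult_leq(2)[of p q] assms(3)]
    ultraD(5)[OF assms(1), of p q] idem_closed[OF assms(2)] idem_closed[OF assms(3)] by blast

lemma ultra_idem_join_iff:
  assumes "ultra x" "idem p" "idem q"
  shows "idem_join p q \<in> x \<longleftrightarrow> p \<in> x \<or> q \<in> x"
  using ultra_neg[OF assms(1) assms(2)] ultra_neg[OF assms(1) assms(3)]
    ultra_neg[OF assms(1) idem_mult[OF idem_neg[OF assms(2)] idem_neg[OF assms(3)]]]
    ultra_mult_iff[OF assms(1) idem_neg[OF assms(2)] idem_neg[OF assms(3)]]
      by (simp add: idem_join_def)

lemma ultra_exists:
  assumes F: "F \<subseteq> Collect idem" "\<one> \<in> F" "\<zero> \<notin> F" "\<And>p q. p \<in> F \<Longrightarrow> q \<in> F \<Longrightarrow> p \<otimes> q \<in> F"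
  shows "\<exists>x. ultra x \<and> F \<subseteq> x"
proof -
  define A where "A = {G. F \<subseteq> G \<and> G \<subseteq> Collect idem \<and> \<zero> \<notin> G \<and> (\<forall>p\<in>G. \<forall>q\<in>G. p \<otimes> q \<in> G)}"
  have "\<exists>G\<in>A. \<forall>X\<in>A. G \<subseteq> X \<longrightarrow> X = G"
  proof (rule subset_Zorn)
    fix C assume C: "subset.chain A C"
    show "\<exists>U\<in>A. \<forall>X\<in>C. X \<subseteq> U"
    proof (cases "C = {}")
      case True
      have "F \<in> A" using F by (simp add: A_def)
      then show ?thesis using True by blast
    next
      case False
      have CA: "C \<subseteq> A"
        and ch: "\<And>X Y. X \<in> C \<Longrightarrow> Y \<in> C \<Longrightarrow> X \<subseteq> Y \<or> Y \<subseteq> X"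
        using C by (auto simp: subset.chain_def)
      have "p \<otimes> q \<in> \<Union>C" if pq: "p \<in> \<Union>C" "q \<in> \<Union>C" for p q
      proof -
        obtain X Y where "X \<in> C" "Y \<in> C" "p \<in> X" "q \<in> Y" using pq by blast
        then obtain Z where "Z \<in> C" "p \<in> Z" "q \<in> Z" using ch[of X Y] by blast
        then show ?thesis using CA unfolding A_def by blast
      qed
      moreover have "F \<subseteq> \<Union>C" "\<Union>C \<subseteq> Collect idem" "\<zero> \<notin> \<Union>C"
        using False CA unfolding A_def by blast+
      ultimately have "\<Union>C \<in> A" unfolding A_def by simp
      then show ?thesis by blast
    qed
  qed
  then obtain G where G: "G \<in> A" "\<And>X. X \<in> A \<Longrightarrow> G \<subseteq> X \<Longrightarrow> X = G"
    by blast
  then have FG: "F \<subseteq> G" "\<zero> \<notin> G"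
    and Gi: "\<And>p. p \<in> G \<Longrightarrow> idem p"
    and Gm: "\<And>p q. p \<in> G \<Longrightarrow> q \<in> G \<Longrightarrow> p \<otimes> q \<in> G"
      by (auto simp: A_def)
  have ext: "p \<in> G \<or> (\<exists>g\<in>G. g \<otimes> p = \<zero>)" if p: "idem p" for p
  proof (rule disjCI)
    assume n: "\<not> (\<exists>g\<in>G. g \<otimes> p = \<zero>)"
    \<comment> \<open>The filter generated by \<open>G\<close> and \<open>p\<close>. It avoids
      \<open>\<zero>\<close> because no member of \<open>G\<close> annihilates \<open>p\<close>, so
      maximality yields \<open>H = G\<close>.\<close>
    define H where "H = {q. idem q \<and> (\<exists>g\<in>G. g \<otimes> p \<preceq> q)}"
    have pc: "p \<in> carrier M" using p idem_closed by blast
    have "q \<otimes> r \<in> H" if qr: "q \<in> H" "r \<in> H" for q r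
    proof -
      obtain f g where fg: "f \<in> G" "g \<in> G" "f \<otimes> p \<preceq> q" "g \<otimes> p \<preceq> r"
        and i: "idem q" "idem r"
        using qr by (auto simp: H_def)
      have c: "f \<in> carrier M" "g \<in> carrier M" using fg Gi idem_closed by blast+
      have "(f \<otimes> g) \<otimes> p = f \<otimes> (g \<otimes> (p \<otimes> p))"
        using p c pc by (simp add: idem_def m_assoc)
      also have "\<dots> = f \<otimes> ((g \<otimes> p) \<otimes> p)"
        using c pc by (simp add: m_assoc)
      also have "\<dots> = f \<otimes> (p \<otimes> (g \<otimes> p))"
        using idem_central[OF p, of "g \<otimes> p"] c pc by simp
      also have "\<dots> = (f \<otimes> p) \<otimes> (g \<otimes> p)"
        using c pc by (simp add: m_assoc)
      also have "\<dots> \<preceq> q \<otimes> r" using mult_mono fg by blast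
      finally show ?thesis using Gm[OF fg(1,2)] idem_mult[OF i] by (auto simp: H_def)
    qed
    moreover have GH: "G \<subseteq> H"
      using mult_leq(1)[OF idem_closed pc] Gi unfolding H_def by blast
    moreover have "\<zero> \<notin> H" using n leq_zeroD by (auto simp: H_def)
    ultimately have "H \<in> A" using FG by (auto simp: A_def H_def)
    then have "H = G" using G(2) GH by blast
    moreover have "p \<in> H" using mult_leq(2)[OF one_mem pc] p FG F(2) unfolding H_def by blast
    ultimately show "p \<in> G" by simp
  qed
  have "p \<in> G \<or> neg p \<in> G" if p: "idem p" for p
  proof (rule ccontr)
    assume n: "\<not> ?thesis"
    then obtain f g where fg: "f \<in> G" "g \<in> G" "f \<otimes> p = \<zero>" "g \<otimes> neg p = \<zero>"
      using ext[OF p] ext[OF idem_neg[OF p]] by blast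
    have c: "f \<in> carrier M" "g \<in> carrier M" "p \<in> carrier M"
      using fg Gi idem_closed p by blast+
    \<comment> \<open>\<open>g\<close> lives on \<open>p\<close> and \<open>f\<close> annihilates
      \<open>p\<close>, so their product would put \<open>\<zero>\<close> into
      \<open>G\<close>.\<close>
    have "f \<otimes> g = f \<otimes> (g \<otimes> p)" using mult_split(4)[of g p] fg c by simp
    also have "\<dots> = f \<otimes> (p \<otimes> g)" using idem_central[OF p] c by simp
    also have "\<dots> = \<zero>" using fg c by (simp add: m_assoc[symmetric])
    finally show False using Gm[OF fg(1,2)] FG by simp
  qed
  then have "ultra G" using FG Gi Gm F(2) by (auto simp: ultra_def)
  then show ?thesis using FG by blast
qed

lemma ultra_containing:
  assumes "idem p" "p \<noteq> \<zero>" shows "\<exists>x. ultra x \<and> p \<in> x"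
proof -
  have p: "p \<in> carrier M" "p \<otimes> p = p" using assms(1) by (auto simp: idem_def)
  have "\<one> \<noteq> \<zero>" using assms(2) p mult_zero(1)[OF p(1)] r_one[OF p(1)] by metis
  then have "\<exists>x. ultra x \<and> {\<one>, p} \<subseteq> x"
    using assms p by (intro ultra_exists) auto
  then show ?thesis by blast
qed

text \<open>The order in the stalk of \<open>M\<close> at \<open>x\<close>, the filtered limit of
  its restrictions to the idempotents of \<open>x\<close>. Comparability makes it total at an
  ultrafilter.\<close>

definition leq_at :: "'a set \<Rightarrow> 'a \<Rightarrow> 'a \<Rightarrow> bool" where
  "leq_at x a b \<longleftrightarrow> a \<in> carrier M \<and> b \<in> carrier M \<and> (\<exists>p\<in>x. p \<otimes> a \<preceq> p \<otimes> b)"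

lemma leq_at_leq: assumes "ultra x" "a \<preceq> b" shows "leq_at x a b"
  using ultraD(3)[OF assms(1)] leqD[OF assms(2)] assms(2) unfolding leq_at_def
  by (intro conjI bexI[of _ \<one>]) auto

text \<open>The product of the two witnesses serves both inequalities, since centrality lets either
  factor act first. Compatibility of the stalk order with transitivity, sum and product then reduces
  to plain inequalities on one idempotent.\<close>

lemma leq_at_common:
  assumes "ultra x" "leq_at x a b" "leq_at x c d"
  obtains p where "p \<in> x" "p \<otimes> a \<preceq> p \<otimes> b" "p \<otimes> c \<preceq> p \<otimes> d"
proof -
  have mem: "a \<in> carrier M" "b \<in> carrier M" "c \<in> carrier M" "d \<in> carrier M"
    using assms by (auto simp: leq_at_def)
  obtain p q where pq: "p \<in> x" "q \<in> x" "p \<otimes> a \<preceq> p \<otimes> b" "q \<otimes> c \<preceq> q \<otimes> d"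
    using assms by (auto simp: leq_at_def)
  have i: "idem p" "p \<in> carrier M" "q \<in> carrier M" using ultraD[OF assms(1)] pq by auto
  have "(p \<otimes> q) \<otimes> c \<preceq> (p \<otimes> q) \<otimes> d"
    using mult_mono1(1)[OF pq(4), of p] i mem by (simp add: m_assoc)
  moreover have "(q \<otimes> p) \<otimes> a \<preceq> (q \<otimes> p) \<otimes> b"
    using mult_mono1(1)[OF pq(3), of q] i mem by (simp add: m_assoc)
  moreover have "p \<otimes> q = q \<otimes> p" using idem_central[OF i(1,3)] .
  ultimately show thesis using that[of "p \<otimes> q"] ultraD(5)[OF assms(1) pq(1,2)] by simp
qed

lemma leq_at_trans: assumes "ultra x" "leq_at x a b" "leq_at x b c" shows "leq_at x a c"
proof -
  obtain p where "p \<in> x" "p \<otimes> a \<preceq> p \<otimes> b" "p \<otimes> b \<preceq> p \<otimes> c"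
    using leq_at_common[OF assms] .
  then show ?thesis using assms leq_trans unfolding leq_at_def by blast
qed

lemma leq_at_add:
  assumes "ultra x" "leq_at x a b" "leq_at x c d" "a \<diamond> c" "b \<diamond> d"
  shows "leq_at x (a \<oplus> c) (b \<oplus> d)"
proof -
  obtain p where p: "p \<in> x" "p \<otimes> a \<preceq> p \<otimes> b" "p \<otimes> c \<preceq> p \<otimes> d"
    using leq_at_common[OF assms(1-3)] .
  then have pc: "p \<in> carrier M" using ultraD(2)[OF assms(1)] by blast
  then have "p \<otimes> (a \<oplus> c) \<preceq> p \<otimes> (b \<oplus> d)"
    using mult_add(1,2)[OF assms(4) pc] mult_add(1,2)[OF assms(5) pc] add_mono p by simp
  then show ?thesis using p perpD(3)[OF assms(4)] perpD(3)[OF assms(5)] by (auto simp: leq_at_def)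
qed

lemma leq_at_mult:
  assumes "ultra x" "leq_at x a b" "leq_at x c d" shows "leq_at x (a \<otimes> c) (b \<otimes> d)"
proof -
  have mem: "a \<in> carrier M" "b \<in> carrier M" "c \<in> carrier M" "d \<in> carrier M"
    using assms by (auto simp: leq_at_def)
  obtain p where p: "p \<in> x" "p \<otimes> a \<preceq> p \<otimes> b" "p \<otimes> c \<preceq> p \<otimes> d"
    using leq_at_common[OF assms] .
  then have "idem p" using ultraD(1)[OF assms(1)] by blast
  then have "p \<otimes> (a \<otimes> c) \<preceq> p \<otimes> (b \<otimes> d)"
    using mult_mono[OF p(2,3)] idem_mult_mult mem by simp
  then show ?thesis using p mem by (auto simp: leq_at_def)
qed

text \<open>On a witness \<open>p\<close>, the products of \<open>p\<close> with \<open>a\<close>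
  and \<open>neg a\<close> add up to \<open>p\<close>, and so do those with \<open>b\<close> and
  \<open>neg b\<close>; cancellation reverses the inequality.\<close>

lemma leq_at_neg:
  assumes "ultra x" "leq_at x a b" shows "leq_at x (neg b) (neg a)"
proof -
  obtain p where p: "p \<in> x" "p \<otimes> a \<preceq> p \<otimes> b"
    using assms by (auto simp: leq_at_def)
  have mem: "a \<in> carrier M" "b \<in> carrier M" "p \<in> carrier M"
    using assms p ultraD(2)[OF assms(1)] by (auto simp: leq_at_def)
  have a: "p \<otimes> a \<diamond> p \<otimes> neg a" "p \<otimes> a \<oplus> p \<otimes> neg a = p"
    using mult_add(1,2)[OF perp_neg(1)[OF mem(1)] mem(3)] perp_neg(2)[OF mem(1)] mem by simp_all
  have b: "p \<otimes> b \<diamond> p \<otimes> neg b" "p \<otimes> b \<oplus> p \<otimes> neg b = p"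
    using mult_add(1,2)[OF perp_neg(1)[OF mem(2)] mem(3)] perp_neg(2)[OF mem(2)] mem by simp_all
  have r: "p \<otimes> neg b \<preceq> p \<otimes> neg b" using mem by simp
  have "p \<otimes> a \<diamond> p \<otimes> neg b" "p \<otimes> a \<oplus> p \<otimes> neg b \<preceq> p \<otimes> a \<oplus> p \<otimes> neg a"
    using perp_mono[OF b(1) p(2) r] add_mono[OF b(1) p(2) r] a b by auto
  then have "p \<otimes> neg b \<preceq> p \<otimes> neg a" using add_leq_cancel a by blast
  then show ?thesis using p mem by (auto simp: leq_at_def)
qed

lemma leq_at_restrict:
  assumes "ultra x" "p \<in> x" "a \<in> carrier M"
  shows "leq_at x a (p \<otimes> a)" "leq_at x (p \<otimes> a) a"
proof -
  have p: "idem p" "p \<in> carrier M" using ultraD[OF assms(1)] assms(2) by auto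
  then have "p \<otimes> (p \<otimes> a) = p \<otimes> a"
    using assms(3) by (simp add: m_assoc[symmetric] idem_def)
  then show "leq_at x a (p \<otimes> a)" "leq_at x (p \<otimes> a) a"
    using p assms unfolding leq_at_def by (metis leq_refl m_closed)+
qed

end

context directed_complete_effect_monoid
begin

lemma leq_at_total:
  assumes "ultra x" "a \<in> carrier M" "b \<in> carrier M" shows "leq_at x a b \<or> leq_at x b a"
proof -
  obtain p where "idem p" "p \<otimes> b \<preceq> p \<otimes> a" "neg p \<otimes> a \<preceq> neg p \<otimes> b"
    using comparability assms by blast
  then show ?thesis using ultraD(6)[OF assms(1), of p] assms unfolding leq_at_def by blast
qed

end

section \<open>Real values at an ultrafilter containing \<open>e\<close>\<close>

context halved_effect_monoid
begin

text \<open>If \<open>s < r\<close>, cancellation shows that a witness \<open>p\<close> annihilates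
  \<open>scalar (r - s)\<close>, hence \<open>e\<close>; but \<open>p\<close> and \<open>e\<close>
  both lie in \<open>x\<close>, and \<open>\<zero>\<close> does not.\<close>

lemma scalar_leq_at_leq:
  assumes "ultra x" "e \<in> x" "r \<in> dyadic" "s \<in> dyadic" "leq_at x (scalar r) (scalar s)"
  shows "r \<le> s"
proof (rule ccontr)
  assume n: "\<not> r \<le> s"
  then have d: "r - s \<in> dyadic" using dyadic_diff assms by simp
  have sum: "scalar s \<diamond> scalar (r - s)" "scalar r = scalar s \<oplus> scalar (r - s)"
    using scalar_add[OF assms(4) d] dyadic_bounds[OF assms(3)] by simp_all
  obtain p where p: "p \<in> x" "p \<otimes> scalar r \<preceq> p \<otimes> scalar s"
    using assms by (auto simp: leq_at_def)
  have pc: "p \<in> carrier M" using ultraD(2) assms(1) p by blast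
  have a: "p \<otimes> scalar s \<diamond> p \<otimes> scalar (r - s)" "p \<otimes> scalar s \<oplus> p \<otimes> scalar (r - s) = p \<otimes> scalar r"
    using mult_add(1,2)[OF sum(1) pc] sum(2) by simp_all
  then have "p \<otimes> scalar s \<oplus> p \<otimes> scalar (r - s) = p \<otimes> scalar s"
    using p(2) leq_addI(1)[OF a(1)] leq_antisym by simp
  then have "p \<otimes> scalar (r - s) = \<zero>" using add_eq_selfD a(1) by blast
  then have "p \<otimes> e = \<zero>" using mult_scalar_zeroD[OF d _ pc] n by simp
  then show False using ultraD(4,5)[OF assms(1)] p assms(2) by metis
qed

lemma leq_at_neg_scalar:
  assumes "ultra x" "e \<in> x" "r \<in> dyadic"
  shows "leq_at x (neg (scalar r)) (scalar (1 - r))" "leq_at x (scalar (1 - r)) (neg (scalar r))"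
  using leq_at_restrict[OF assms(1,2), of "neg (scalar r)"] e_neg_scalar scalar_closed assms
  by simp_all

text \<open>A standard part: infinitesimal differences are lost, so only strict inequalities with a
  value translate back into inequalities at \<open>x\<close>. This is why the arguments below keep
  dyadics strictly inside gaps.\<close>

definition value_at :: "'a set \<Rightarrow> 'a \<Rightarrow> real" where
  "value_at x a = Sup {r \<in> dyadic. leq_at x (scalar r) a}"

lemma value_set:
  assumes "ultra x" "a \<in> carrier M"
  shows "0 \<in> {r \<in> dyadic. leq_at x (scalar r) a}" "bdd_above {r \<in> dyadic. leq_at x (scalar r) a}"
  using leq_at_leq[OF assms(1) zero_leq[OF assms(2)]] dyadic_bounds
  by (auto intro: bdd_aboveI[of _ 1])

lemma leq_value_at:
  assumes "ultra x" "r \<in> dyadic" "leq_at x (scalar r) a" shows "r \<le> value_at x a"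
proof -
  have "a \<in> carrier M" using assms by (simp add: leq_at_def)
  then show ?thesis unfolding value_at_def
    using value_set[OF assms(1)] assms by (intro cSup_upper) auto
qed

lemma value_at_leqI:
  assumes "ultra x" "a \<in> carrier M" "\<And>r. r \<in> dyadic \<Longrightarrow> leq_at x (scalar r) a \<Longrightarrow> r \<le> t"
  shows "value_at x a \<le> t"
  unfolding value_at_def
proof (rule cSup_least)
  show "{r \<in> dyadic. leq_at x (scalar r) a} \<noteq> {}"
    using value_set(1)[OF assms(1,2)] by blast
qed (use assms(3) in blast)

lemma value_at_bounds:
  assumes "ultra x" "a \<in> carrier M" shows "0 \<le> value_at x a" "value_at x a \<le> 1"
  using leq_value_at[OF assms(1), of 0 a] value_set(1)[OF assms] value_at_leqI[OF assms, of 1] dyadic_bounds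
  by auto

lemma leq_at_below_value_at:
  assumes "ultra x" "a \<in> carrier M" "r \<in> dyadic" "r < value_at x a"
  shows "leq_at x (scalar r) a"
proof -
  obtain s where s: "s \<in> dyadic" "leq_at x (scalar s) a" "r < s"
    using less_cSupE[of r "{r \<in> dyadic. leq_at x (scalar r) a}"] assms(4) value_set(1)[OF assms(1,2)]
    unfolding value_at_def by blast
  then have "leq_at x (scalar r) (scalar s)"
    using leq_at_leq[OF assms(1) scalar_mono] assms(3) by simp
  then show ?thesis using leq_at_trans assms(1) s by blast
qed

lemma leq_at_above_value_at:
  assumes "ultra x" "a \<in> carrier M" "r \<in> dyadic" "value_at x a < r"
  shows "leq_at x a (scalar r)"
  using leq_at_total[OF assms(1,2) scalar_closed[OF assms(3)]] leq_value_at[OF assms(1,3), of a] assms(4)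
  by auto

lemma value_at_leq_dyadic:
  assumes "ultra x" "e \<in> x" "r \<in> dyadic" "leq_at x a (scalar r)"
  shows "value_at x a \<le> r"
proof (rule value_at_leqI[OF assms(1)])
  show "a \<in> carrier M" using assms by (simp add: leq_at_def)
  show "s \<le> r" if "s \<in> dyadic" "leq_at x (scalar s) a" for s
    using scalar_leq_at_leq[OF assms(1,2) that(1) assms(3)] leq_at_trans[OF assms(1) that(2) assms(4)]
    by blast
qed

lemma value_at_mono:
  assumes "ultra x" "leq_at x a b" shows "value_at x a \<le> value_at x b"
proof (rule value_at_leqI[OF assms(1)])
  show "a \<in> carrier M" using assms by (simp add: leq_at_def)
  show "s \<le> value_at x b" if "s \<in> dyadic" "leq_at x (scalar s) a" for s
    using leq_value_at[OF assms(1) that(1)] leq_at_trans[OF assms(1) that(2) assms(2)] by blast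
qed

lemma value_at_scalar:
  assumes "ultra x" "e \<in> x" "r \<in> dyadic" shows "value_at x (scalar r) = r"
  using value_at_leq_dyadic[OF assms, of "scalar r"] leq_value_at[OF assms(1,3), of "scalar r"]
    leq_at_leq[OF assms(1) leq_refl[OF scalar_closed[OF assms(3)]]] by simp

lemma value_at_zero: "ultra x \<Longrightarrow> e \<in> x \<Longrightarrow> value_at x \<zero> = 0"
  using value_at_scalar[of x 0] by simp

lemma value_at_restrict:
  assumes "ultra x" "p \<in> x" "a \<in> carrier M"
  shows "value_at x (p \<otimes> a) = value_at x a"
  using value_at_mono[OF assms(1) leq_at_restrict(1)[OF assms]] value_at_mono[OF assms(1) leq_at_restrict(2)[OF assms]]
  by simp

lemma value_at_restrict_zero:
  assumes "ultra x" "e \<in> x" "idem p" "p \<notin> x" "a \<in> carrier M"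
  shows "value_at x (p \<otimes> a) = 0"
proof -
  have c: "p \<in> carrier M" using assms idem_closed by blast
  have "neg p \<in> x" using ultra_neg assms by blast
  then have "value_at x (p \<otimes> a) = value_at x (neg p \<otimes> (p \<otimes> a))"
    using value_at_restrict assms c by simp
  also have "neg p \<otimes> (p \<otimes> a) = \<zero>"
    using idem_mult_neg(2)[OF assms(3)] c assms by (simp add: m_assoc[symmetric])
  finally show ?thesis using value_at_zero assms by simp
qed

lemma value_at_one:
  assumes "ultra x" "e \<in> x" shows "value_at x \<one> = 1"
  using value_at_restrict[OF assms one_mem] value_at_scalar[OF assms dyadic_one] by simp

text \<open>A gap in either direction has room for dyadics \<open>r < s\<close>. At \<open>x\<close>
  they yield \<open>scalar s\<close> below \<open>neg a\<close> below \<open>scalar r\<close>, hence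
  \<open>s \<le> r\<close>.\<close>

lemma value_at_neg:
  assumes "ultra x" "e \<in> x" "a \<in> carrier M" shows "value_at x (neg a) = 1 - value_at x a"
proof (rule antisym; rule ccontr)
  note b = value_at_bounds[OF assms(1,3)] value_at_bounds[OF assms(1) neg_closed[OF assms(3)]]
  {
    assume "\<not> value_at x (neg a) \<le> 1 - value_at x a"
    then have "1 - value_at x a < value_at x (neg a)" by simp
    then obtain s where s: "s \<in> dyadic" "1 - value_at x a < s" "s < value_at x (neg a)"
      using dyadic_dense[of "1 - value_at x a" "value_at x (neg a)"] b by auto
    then obtain r where r: "r \<in> dyadic" "1 - value_at x a < r" "r < s"
      using dyadic_dense[of "1 - value_at x a" s] b by auto
    have d: "1 - r \<in> dyadic" using dyadic_diff[of r 1] r dyadic_bounds by simp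
    have 1: "leq_at x (scalar s) (neg a)" using leq_at_below_value_at assms s by simp
    have "leq_at x (scalar (1 - r)) a" using leq_at_below_value_at[OF assms(1,3) d] r by simp
    then have 2: "leq_at x (neg a) (neg (scalar (1 - r)))" using leq_at_neg assms by blast
    have 3: "leq_at x (neg (scalar (1 - r))) (scalar r)"
      using leq_at_neg_scalar(1)[OF assms(1,2) d] by simp
    have "s \<le> r" using scalar_leq_at_leq[OF assms(1,2) s(1) r(1)] leq_at_trans[OF assms(1)] 1 2 3
      by blast
    then show False using r by simp
  next
    assume "\<not> 1 - value_at x a \<le> value_at x (neg a)"
    then have "value_at x (neg a) < 1 - value_at x a" by simp
    then obtain s where s: "s \<in> dyadic" "value_at x (neg a) < s" "s < 1 - value_at x a"
      using dyadic_dense[of "value_at x (neg a)" "1 - value_at x a"] b by auto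
    then obtain r where r: "r \<in> dyadic" "value_at x (neg a) < r" "r < s"
      using dyadic_dense[of "value_at x (neg a)" s] b by auto
    have d: "1 - s \<in> dyadic" using dyadic_diff[of s 1] s dyadic_bounds by simp
    have 1: "leq_at x (neg a) (scalar r)" using leq_at_above_value_at assms r by simp
    have "leq_at x a (scalar (1 - s))" using leq_at_above_value_at[OF assms(1,3) d] s by simp
    then have 2: "leq_at x (neg (scalar (1 - s))) (neg a)" using leq_at_neg assms by blast
    have 3: "leq_at x (scalar s) (neg (scalar (1 - s)))"
      using leq_at_neg_scalar(2)[OF assms(1,2) d] by simp
    have "s \<le> r" using scalar_leq_at_leq[OF assms(1,2) s(1) r(1)] leq_at_trans[OF assms(1)] 1 2 3
      by blast
    then show False using r by simp
  }
qed

lemma value_at_add: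
  assumes "ultra x" "e \<in> x" "a \<diamond> b"
  shows "value_at x (a \<oplus> b) = value_at x a + value_at x b"
proof (rule antisym)
  have mem: "a \<in> carrier M" "b \<in> carrier M" "a \<oplus> b \<in> carrier M"
    using perpD assms(3) by blast+
  \<comment> \<open>Orthogonality bounds the sum of the two values by 1, so dyadics below them stay
    summable and \<open>scalar (r + s)\<close> is available.\<close>
  have "leq_at x b (neg a)" using leq_at_leq[OF assms(1)] perp_iff[of b a] perp_sym[OF assms(3)]
    by blast
  then have le1: "value_at x a + value_at x b \<le> 1"
    using value_at_mono[OF assms(1)] value_at_neg[OF assms(1,2) mem(1)] by fastforce
  note ba = value_at_bounds[OF assms(1) mem(1)] and bb = value_at_bounds[OF assms(1) mem(2)]
    and bs = value_at_bounds[OF assms(1) mem(3)]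
  show "value_at x (a \<oplus> b) \<le> value_at x a + value_at x b"
  proof (rule ccontr)
    assume "\<not> ?thesis"
    then have lt: "value_at x a + value_at x b < value_at x (a \<oplus> b)" by simp
    \<comment> \<open>Half of the gap for each summand: \<open>r\<close> and \<open>s\<close> lie
      strictly above the two values while \<open>r + s\<close> stays below the value of the
      sum.\<close>
    define \<delta> where "\<delta> = (value_at x (a \<oplus> b) - value_at x a - value_at x b) / 2"
    have \<delta>: "0 < \<delta>" "value_at x a + \<delta> + (value_at x b + \<delta>) = value_at x (a \<oplus> b)"
      using lt by (simp_all add: \<delta>_def field_simps)
    obtain r where r: "r \<in> dyadic" "value_at x a < r" "r < value_at x a + \<delta>"
      using dyadic_dense[of "value_at x a" "value_at x a + \<delta>"] ba bb bs \<delta> by auto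
    obtain s where s: "s \<in> dyadic" "value_at x b < s" "s < value_at x b + \<delta>"
      using dyadic_dense[of "value_at x b" "value_at x b + \<delta>"] ba bb bs \<delta> by auto
    have rs: "r + s < value_at x (a \<oplus> b)" using r s \<delta> by simp
    then have rs1: "r + s \<le> 1" using bs by simp
    have "leq_at x (a \<oplus> b) (scalar (r + s))"
      using leq_at_add[OF assms(1) leq_at_above_value_at[OF assms(1) mem(1) r(1,2)] leq_at_above_value_at[OF assms(1) mem(2) s(1,2)] assms(3)]
        scalar_add[OF r(1) s(1) rs1] by simp
    then have "value_at x (a \<oplus> b) \<le> r + s"
      using value_at_leq_dyadic[OF assms(1,2) dyadic_add[OF r(1) s(1) rs1]] by simp
    then show False using rs by simp
  qed
  have 1: "r + s \<le> value_at x (a \<oplus> b)" if r: "r \<in> dyadic" "leq_at x (scalar r) a"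
    and s: "s \<in> dyadic" "leq_at x (scalar s) b" for r s
  proof -
    have rs1: "r + s \<le> 1" using leq_value_at[OF assms(1) r] leq_value_at[OF assms(1) s] le1
      by linarith
    have "leq_at x (scalar (r + s)) (a \<oplus> b)"
      using leq_at_add[OF assms(1) r(2) s(2) _ assms(3)] scalar_add[OF r(1) s(1) rs1] by simp
    then show ?thesis using leq_value_at[OF assms(1) dyadic_add[OF r(1) s(1) rs1]] by simp
  qed
  have "value_at x b \<le> value_at x (a \<oplus> b) - r" if "r \<in> dyadic" "leq_at x (scalar r) a" for r
    using value_at_leqI[OF assms(1) mem(2), of "value_at x (a \<oplus> b) - r"] 1[OF that]
    by fastforce
  then have "value_at x a \<le> value_at x (a \<oplus> b) - value_at x b"
    using value_at_leqI[OF assms(1) mem(1), of "value_at x (a \<oplus> b) - value_at x b"]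
    by fastforce
  then show "value_at x a + value_at x b \<le> value_at x (a \<oplus> b)" by simp
qed

text \<open>Products of dyadics below the factors are dyadics below the product. The supremum is
  taken in one factor at a time after division by the other, whence the separate cases for
  zero.\<close>

lemma value_at_mult_ge:
  assumes "ultra x" "e \<in> x" "a \<in> carrier M" "b \<in> carrier M"
  shows "value_at x a * value_at x b \<le> value_at x (a \<otimes> b)"
proof -
  let ?c = "value_at x (a \<otimes> b)"
  note bc = value_at_bounds[OF assms(1) m_closed[OF assms(3,4)]]
  note ba = value_at_bounds[OF assms(1,3)] and bb = value_at_bounds[OF assms(1,4)]
  have 1: "r * s \<le> ?c" if r: "r \<in> dyadic" "leq_at x (scalar r) a"
    and s: "s \<in> dyadic" "leq_at x (scalar s) b" for r s
    using leq_value_at[OF assms(1) dyadic_mult[OF r(1) s(1)]] leq_at_mult[OF assms(1) r(2) s(2)] scalar_mult[OF r(1) s(1)]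
    by simp
  have 2: "r * value_at x b \<le> ?c" if r: "r \<in> dyadic" "leq_at x (scalar r) a" for r
  proof (cases "r = 0")
    case False
    then have r0: "0 < r" using dyadic_bounds[OF r(1)] by simp
    have "value_at x b \<le> ?c / r"
      using value_at_leqI[OF assms(1,4), of "?c / r"] 1[OF r] r0 by (simp add: field_simps)
    then show ?thesis using r0 by (simp add: field_simps)
  qed (use bc in simp)
  show ?thesis
  proof (cases "value_at x b = 0")
    case False
    then have b0: "0 < value_at x b" using bb by simp
    have "value_at x a \<le> ?c / value_at x b"
      using value_at_leqI[OF assms(1,3), of "?c / value_at x b"] 2 b0 by (simp add: field_simps)
    then show ?thesis using b0 by (simp add: field_simps)
  qed (use bc in simp)
qed

text \<open>The upper bound is the lower bound for \<open>neg b\<close> in disguise: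
  \<open>a = a \<otimes> b \<oplus> a \<otimes> neg b\<close>, and values are additive.\<close>

lemma value_at_mult:
  assumes "ultra x" "e \<in> x" "a \<in> carrier M" "b \<in> carrier M"
  shows "value_at x (a \<otimes> b) = value_at x a * value_at x b"
proof (rule antisym[OF _ value_at_mult_ge[OF assms]])
  have "value_at x a = value_at x (a \<otimes> b) + value_at x (a \<otimes> neg b)"
    using value_at_add[OF assms(1,2) mult_split(3)[OF assms(3,4)]] mult_split(4)[OF assms(3,4)]
    by simp
  moreover have "value_at x a * (1 - value_at x b) \<le> value_at x (a \<otimes> neg b)"
    using value_at_mult_ge[OF assms(1-3) neg_closed[OF assms(4)]] value_at_neg[OF assms(1,2,4)]
    by simp
  ultimately show "value_at x (a \<otimes> b) \<le> value_at x a * value_at x b"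
    by (simp add: algebra_simps)
qed

text \<open>Where \<open>p\<close> puts \<open>b\<close> below \<open>a\<close>, the surplus
  \<open>d\<close> of \<open>a\<close> within \<open>e\<close> has value 0 at every point. Such an
  infinitesimal lies below every \<open>half_power n\<close> and vanishes by the Archimedean
  property; on \<open>neg p\<close> the inequality holds already.\<close>

lemma value_at_reflects:
  assumes "a \<in> carrier M" "b \<in> carrier M" "\<And>x. ultra x \<Longrightarrow> e \<in> x \<Longrightarrow> value_at x a \<le> value_at x b"
  shows "e \<otimes> a \<preceq> e \<otimes> b"
proof -
  obtain p where p: "idem p" "p \<otimes> b \<preceq> p \<otimes> a" "neg p \<otimes> a \<preceq> neg p \<otimes> b"
    using comparability[OF assms(1,2)] by blast
  have pc: "p \<in> carrier M" using p idem_closed by blast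
  have ip: "idem (p \<otimes> e)" using idem_mult[OF p(1) e_idem] .
  have c: "e \<otimes> (p \<otimes> c) = p \<otimes> (e \<otimes> c)" if "c \<in> carrier M" for c
    using idem_central[OF p(1) e_closed] that pc by (simp add: m_assoc[symmetric])
  have "e \<otimes> (p \<otimes> b) \<preceq> e \<otimes> (p \<otimes> a)"
    using mult_mono1(1)[OF p(2)] by simp
  then obtain d where d: "e \<otimes> (p \<otimes> b) \<diamond> d" "e \<otimes> (p \<otimes> a) = e \<otimes> (p \<otimes> b) \<oplus> d" "d \<in> carrier M"
    by (rule leqE)
  have "d \<preceq> e \<otimes> (p \<otimes> a)" using leq_addI(2)[OF d(1)] d(2) by simp
  then have de: "d \<preceq> e"
    using mult_leq(1)[of e "p \<otimes> a"] leq_trans assms(1) pc by simp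
  have hd: "value_at x d = 0" if x: "ultra x" "e \<in> x" for x
  proof -
    have h: "value_at x (e \<otimes> (p \<otimes> c)) = value_at x p * value_at x c" if "c \<in> carrier M" for c
      using value_at_restrict[OF x, of "p \<otimes> c"] value_at_mult[OF x pc that] pc that by simp
    have "value_at x p * value_at x a = value_at x p * value_at x b + value_at x d"
      using value_at_add[OF x d(1)] d(2) h[OF assms(1)] h[OF assms(2)] by simp
    moreover have "value_at x p * value_at x a \<le> value_at x p * value_at x b"
      using assms(3)[OF x] value_at_bounds(1)[OF x(1) pc] by (rule mult_left_mono)
    ultimately show ?thesis using value_at_bounds(1)[OF x(1) d(3)] by simp
  qed
  have "d \<preceq> half_power n" for n
  proof -
    \<comment> \<open>An ultrafilter through \<open>q \<otimes> e\<close> would give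
      \<open>d\<close> a value of at least \<open>1 / 2 ^ n\<close>. So \<open>q\<close> misses
      \<open>e\<close>, and \<open>d\<close>, being below \<open>e\<close>, lives on
      \<open>neg q\<close>, where it is dominated by \<open>half_power n\<close>.\<close>
    obtain q where q: "idem q" "q \<otimes> half_power n \<preceq> q \<otimes> d" "neg q \<otimes> d \<preceq> neg q \<otimes> half_power n"
      using comparability[OF d(3) half_power_closed] by blast
    have qc: "q \<in> carrier M" using q idem_closed by blast
    have "q \<otimes> e = \<zero>"
    proof (rule ccontr)
      assume n: "q \<otimes> e \<noteq> \<zero>"
      have iq: "idem (q \<otimes> e)" using idem_mult[OF q(1) e_idem] .
      then obtain x where x: "ultra x" "q \<otimes> e \<in> x"
        using ultra_containing[OF iq n] by blast
      have ex: "e \<in> x" and qx: "q \<in> x" using ultra_mult_iff[OF x(1) q(1) e_idem] x by auto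
      have dy: "real 1 / 2 ^ n \<in> dyadic" using dyadicI[of 1 n] by simp
      have "scalar (real 1 / 2 ^ n) = half_power n"
        using scalar_eq[of 1 n] by (simp add: dyadic_multiple_def)
      then have "leq_at x (scalar (real 1 / 2 ^ n)) d" using q(2) qx d(3) by (auto simp: leq_at_def)
      then have "real 1 / 2 ^ n \<le> 0" using leq_value_at[OF x(1) dy] hd[OF x(1) ex] by metis
      then show False by (simp add: divide_simps)
    qed
    then have "q \<otimes> d \<preceq> \<zero>" using mult_mono1(1)[OF de qc] by simp
    then have "d = neg q \<otimes> d"
      using leq_zeroD[of "q \<otimes> d"] mult_split(2)[OF d(3) qc] d(3) qc by simp
    also have "\<dots> \<preceq> neg q \<otimes> half_power n" by (rule q)
    also have "\<dots> \<preceq> half_power n" using mult_leq qc by simp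
    finally show ?thesis .
  qed
  then have "d = \<zero>" by (rule leq_half_power_zero)
  then have 1: "p \<otimes> (e \<otimes> a) = p \<otimes> (e \<otimes> b)"
    using d(2) c[OF assms(1)] c[OF assms(2)] perpD(1)[OF d(1)] by simp
  have 2: "neg p \<otimes> (e \<otimes> a) \<preceq> neg p \<otimes> (e \<otimes> b)"
    using mult_mono1(1)[OF p(3), of e] idem_central[OF idem_neg[OF p(1)] e_closed] pc assms(1,2)
    by (simp add: m_assoc[symmetric])
  have s: "p \<otimes> (e \<otimes> b) \<diamond> neg p \<otimes> (e \<otimes> b)" "p \<otimes> (e \<otimes> b) \<oplus> neg p \<otimes> (e \<otimes> b) = e \<otimes> b"
    "p \<otimes> (e \<otimes> a) \<oplus> neg p \<otimes> (e \<otimes> a) = e \<otimes> a"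
    using mult_split[of "e \<otimes> b" p] mult_split[of "e \<otimes> a" p] assms(1,2) pc by auto
  have "p \<otimes> (e \<otimes> a) \<preceq> p \<otimes> (e \<otimes> b)"
    using 1 assms(1,2) pc by simp
  then show ?thesis using add_mono[OF s(1) _ 2, of "p \<otimes> (e \<otimes> a)"] s by simp
qed

end


section \<open>The Stone space\<close>

context effect_monoid
begin

text \<open>Otherwise the nonzero idempotent \<open>p \<otimes> neg q\<close> lies in an
  ultrafilter, which then contains \<open>p\<close> but not \<open>q\<close>. Boolean identities
  between idempotents thus become propositional statements about membership.\<close>

lemma idem_leq_ultra:
  assumes "idem p" "idem q" "\<And>x. ultra x \<Longrightarrow> p \<in> x \<Longrightarrow> q \<in> x"
  shows "p \<preceq> q"
proof -
  have c: "p \<in> carrier M" "q \<in> carrier M" using assms(1,2) idem_closed by auto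
  have i: "idem (p \<otimes> neg q)" using idem_mult[OF assms(1) idem_neg[OF assms(2)]] .
  have "p \<otimes> neg q = \<zero>"
  proof (rule ccontr)
    assume "p \<otimes> neg q \<noteq> \<zero>"
    then obtain x where x: "ultra x" "p \<otimes> neg q \<in> x"
      using ultra_containing[OF i] by blast
    then show False
      using ultra_mult_iff[OF x(1) assms(1) idem_neg[OF assms(2)]] ultra_neg[OF x(1) assms(2)] assms(3)[OF x(1)]
      by simp
  qed
  then have "p \<otimes> q = p" using mult_split(4)[OF c] c by simp
  then show ?thesis using mult_leq(2)[OF c] by simp
qed

lemma idem_eq_ultra:
  assumes "idem p" "idem q" "\<And>x. ultra x \<Longrightarrow> p \<in> x \<longleftrightarrow> q \<in> x"
  shows "p = q"
  using idem_leq_ultra[OF assms(1,2)] idem_leq_ultra[OF assms(2,1)] assms(3) leq_antisym by blast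

end

context directed_complete_effect_monoid
begin

lemma sup_idem:
  assumes "up_directed D" "is_sup D s" "\<And>d. d \<in> D \<Longrightarrow> idem d"
  shows "idem s"
proof -
  have D: "D \<subseteq> carrier M" "D \<noteq> {}" "\<And>a b. a \<in> D \<Longrightarrow> b \<in> D \<Longrightarrow> \<exists>c\<in>D. a \<preceq> c \<and> b \<preceq> c"
    using assms(1) unfolding up_directed_def by blast+
  have "neg ` neg ` D = D" using D(1) by (force simp: image_iff)
  moreover have "neg ` D \<subseteq> carrier M" using D(1) by auto
  ultimately have "is_inf (neg ` D) (neg s)" using is_inf_neg[of "neg ` D" s] assms(2) by simp
  moreover have "\<exists>z\<in>neg ` D. z \<preceq> neg a \<and> z \<preceq> neg b" if "a \<in> D" "b \<in> D" for a b
    using D(3)[OF that] neg_leq by blast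
  then have "down_directed (neg ` D)" using D(1,2) unfolding down_directed_def by auto
  ultimately have "idem (neg s)" using inf_idem[of "neg ` D" "neg s"] assms(3) idem_neg by auto
  then show ?thesis using idem_neg[of "neg s"] is_sup_closed[OF assms(2)] by simp
qed

end

context halved_effect_monoid
begin

text \<open>The Stone space of the idempotents below \<open>e\<close>, presented through
  ultrafilters of all idempotents; it is empty when \<open>e = \<zero>\<close>.\<close>

definition points :: "'a set set" where "points = {x. ultra x \<and> e \<in> x}"

definition basic :: "'a \<Rightarrow> 'a set set" where "basic p = {x \<in> points. p \<in> x}"

definition stone :: "'a set topology" where
  "stone = topology (\<lambda>U. U \<subseteq> points \<and> (\<forall>x\<in>U. \<exists>p\<in>x. basic p \<subseteq> U))"

lemma basic_mult: "idem p \<Longrightarrow> idem q \<Longrightarrow> basic (p \<otimes> q) = basic p \<inter> basic q"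
  using ultra_mult_iff by (auto simp: basic_def points_def)

lemma basic_idem_join: "idem p \<Longrightarrow> idem q \<Longrightarrow> basic (idem_join p q) = basic p \<union> basic q"
  using ultra_idem_join_iff by (auto simp: basic_def points_def)

lemma basic_neg: "idem p \<Longrightarrow> basic (neg p) = points - basic p"
  using ultra_neg by (auto simp: basic_def points_def)

lemma openin_stone: "openin stone U \<longleftrightarrow> U \<subseteq> points \<and> (\<forall>x\<in>U. \<exists>p\<in>x. basic p \<subseteq> U)"
proof -
  have "istopology (\<lambda>U. U \<subseteq> points \<and> (\<forall>x\<in>U. \<exists>p\<in>x. basic p \<subseteq> U))"
    unfolding istopology_def
  proof (rule conjI; intro allI impI)
    fix S T :: "'a set set"
    assume S: "S \<subseteq> points \<and> (\<forall>x\<in>S. \<exists>p\<in>x. basic p \<subseteq> S)"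
      and T: "T \<subseteq> points \<and> (\<forall>x\<in>T. \<exists>p\<in>x. basic p \<subseteq> T)"
    have "\<exists>p\<in>x. basic p \<subseteq> S \<inter> T" if x: "x \<in> S \<inter> T" for x
    proof -
      have "\<exists>p\<in>x. basic p \<subseteq> S" "\<exists>p\<in>x. basic p \<subseteq> T" "x \<in> points"
        using S T x by auto
      then obtain p q where pq: "p \<in> x" "q \<in> x" "basic p \<subseteq> S" "basic q \<subseteq> T"
        and u: "ultra x"
        by (auto simp: points_def)
      have "basic (p \<otimes> q) \<subseteq> S \<inter> T"
        using basic_mult[OF ultraD(1)[OF u pq(1)] ultraD(1)[OF u pq(2)]] pq(3,4) by blast
      then show ?thesis using ultraD(5)[OF u pq(1,2)] by blast
    qed
    then show "S \<inter> T \<subseteq> points \<and> (\<forall>x\<in>S \<inter> T. \<exists>p\<in>x. basic p \<subseteq> S \<inter> T)"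
      using S by blast
  next
    fix K :: "'a set set set"
    assume K: "\<forall>S\<in>K. S \<subseteq> points \<and> (\<forall>x\<in>S. \<exists>p\<in>x. basic p \<subseteq> S)"
    have "\<exists>p\<in>x. basic p \<subseteq> \<Union>K" if x: "x \<in> \<Union>K" for x
    proof -
      obtain S where S: "S \<in> K" "x \<in> S" using x by blast
      then have "\<exists>p\<in>x. basic p \<subseteq> S" using K by simp
      then show ?thesis using S by blast
    qed
    then show "\<Union>K \<subseteq> points \<and> (\<forall>x\<in>\<Union>K. \<exists>p\<in>x. basic p \<subseteq> \<Union>K)"
      using K by blast
  qed
  then show ?thesis by (simp add: stone_def)
qed

lemma openin_stoneD:
  assumes "openin stone U" "x \<in> U"
  shows "ultra x" "e \<in> x" "x \<in> points" "\<exists>p\<in>x. basic p \<subseteq> U"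
  using assms by (auto simp: openin_stone points_def)

lemma openin_basic: "openin stone (basic p)"
  unfolding openin_stone by (auto simp: basic_def)

lemma topspace_stone: "topspace stone = points"
proof -
  have "openin stone points"
    unfolding openin_stone using ultraD(3) by (auto simp: basic_def points_def)
  moreover have "U \<subseteq> points" if "openin stone U" for U using that openin_stone by simp
  ultimately show ?thesis unfolding topspace_def by blast
qed

text \<open>\<open>F\<close> holds the idempotents outside which the space is finitely covered. If
  \<open>\<zero>\<close> is among them, the whole space is. Otherwise an ultrafilter through
  \<open>F\<close> is a point, as \<open>e \<in> F\<close>, and a basic neighbourhood
  \<open>basic p\<close> of it inside one member of the cover puts \<open>neg p\<close> into
  \<open>F\<close>, against \<open>p \<in> x\<close>.\<close>

lemma compact_stone: "compact_space stone"
  unfolding compact_space_alt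
proof (intro allI impI)
  fix \<U> :: "'a set set set"
  assume \<U>: "(\<forall>U\<in>\<U>. openin stone U) \<and> topspace stone \<subseteq> \<Union>\<U>"
  define F where "F = {q. idem q \<and> (\<exists>V. finite V \<and> V \<subseteq> \<U> \<and> basic (neg q) \<subseteq> \<Union>V)}"
  show "\<exists>\<F>. finite \<F> \<and> \<F> \<subseteq> \<U> \<and> topspace stone \<subseteq> \<Union>\<F>"
  proof (cases "\<zero> \<in> F")
    case True
    then obtain V where "finite V" "V \<subseteq> \<U>" "basic \<one> \<subseteq> \<Union>V"
      by (auto simp: F_def)
    moreover have "basic \<one> = points" using ultraD(3) by (auto simp: basic_def points_def)
    ultimately show ?thesis using topspace_stone by metis
  next
    case False
    have Fi: "q \<in> F" if "idem q" "basic (neg q) = {}" for q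
      unfolding F_def using that by (auto intro!: exI[of _ "{}"])
    have eF: "e \<in> F"
      using Fi[OF e_idem] basic_neg[OF e_idem] by (auto simp: basic_def points_def)
    have 1: "\<one> \<in> F"
      using Fi[OF idem_one] basic_neg[OF idem_one] ultraD(3) by (auto simp: basic_def points_def)
    have "p \<otimes> q \<in> F" if pq: "p \<in> F" "q \<in> F" for p q
    proof -
      obtain V W where *: "finite V" "V \<subseteq> \<U>" "basic (neg p) \<subseteq> \<Union>V" "finite W" "W \<subseteq> \<U>" "basic (neg q) \<subseteq> \<Union>W"
        and i: "idem p" "idem q" using pq by (auto simp: F_def)
      have "basic (neg (p \<otimes> q)) = basic (neg p) \<union> basic (neg q)"
        using basic_neg[OF i(1)] basic_neg[OF i(2)] basic_neg[OF idem_mult[OF i]] basic_mult[OF i]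
        by blast
      then have "basic (neg (p \<otimes> q)) \<subseteq> \<Union>(V \<union> W)" "finite (V \<union> W)" "V \<union> W \<subseteq> \<U>"
        using * by auto
      then show ?thesis using idem_mult[OF i] unfolding F_def by blast
    qed
    then obtain x where x: "ultra x" "F \<subseteq> x"
      using ultra_exists[of F] 1 False by (auto simp: F_def)
    then have "x \<in> points" using eF by (auto simp: points_def)
    then obtain U where U: "U \<in> \<U>" "x \<in> U" using \<U> topspace_stone by blast
    have "openin stone U" using \<U> U(1) by simp
    then obtain p where p: "p \<in> x" "basic p \<subseteq> U" using openin_stoneD(4) U(2) by blast
    have ip: "idem p" using ultraD(1)[OF x(1) p(1)] .
    have "basic (neg (neg p)) \<subseteq> \<Union>{U}" using p(2) idem_closed[OF ip] by simp
    moreover have "finite {U}" "{U} \<subseteq> \<U>" using U by auto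
    ultimately have "neg p \<in> F" unfolding F_def using idem_neg[OF ip] by blast
    then show ?thesis using ultra_neg[OF x(1) ip] p x by blast
  qed
qed

lemma Hausdorff_stone: "Hausdorff_space stone"
  unfolding Hausdorff_space_def topspace_stone
proof (intro allI impI)
  fix x y assume xy: "x \<in> points \<and> y \<in> points \<and> x \<noteq> y"
  then have u: "ultra x" "ultra y" by (auto simp: points_def)
  \<comment> \<open>Proper inclusion between ultrafilters is impossible, as complements would
    reverse it.\<close>
  have "\<exists>p. p \<in> x \<and> p \<notin> y"
  proof (rule ccontr)
    assume n: "\<nexists>p. p \<in> x \<and> p \<notin> y"
    then obtain q where q: "q \<in> y" "q \<notin> x" using xy by blast
    then have "neg q \<in> x" "neg q \<notin> y" using ultra_neg ultraD(1) u by blast+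
    then show False using n by blast
  qed
  then obtain p where p: "p \<in> x" "p \<notin> y" by blast
  then have ip: "idem p" using ultraD(1) u by blast
  have "x \<in> basic p" "y \<in> basic (neg p)" "disjnt (basic p) (basic (neg p))"
    using p xy basic_neg[OF ip] by (auto simp: basic_def disjnt_def)
  then show "\<exists>U V. openin stone U \<and> openin stone V \<and> x \<in> U \<and> y \<in> V \<and> disjnt U V"
    using openin_basic by blast
qed

text \<open>The closure of \<open>U\<close> is \<open>basic s\<close> for the supremum
  \<open>s\<close> of the idempotents whose basic sets lie in \<open>U\<close>: if
  \<open>basic r\<close> misses \<open>U\<close>, then \<open>neg r\<close> bounds all of them and
  therefore \<open>s\<close>.\<close>

lemma extremally_disconnected_stone: "extremally_disconnected_space stone"
  unfolding extremally_disconnected_space_def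
proof (intro allI impI)
  fix U assume U: "openin stone U"
  \<comment> \<open>With \<open>q \<preceq> e\<close>, every ultrafilter containing \<open>q\<close>
    is a point, so \<open>basic q\<close> determines \<open>q\<close>.\<close>
  define Q where "Q = {q. idem q \<and> q \<preceq> e \<and> basic q \<subseteq> U}"
  have "up_directed Q"
    unfolding up_directed_def
  proof (intro conjI ballI)
    show "Q \<subseteq> carrier M" using idem_closed by (auto simp: Q_def)
    have "basic \<zero> = {}" using ultraD(4) by (auto simp: basic_def points_def)
    then have "\<zero> \<in> Q" by (simp add: Q_def)
    then show "Q \<noteq> {}" by blast
    fix p q assume "p \<in> Q" "q \<in> Q"
    then have pq: "idem p" "idem q" "p \<preceq> e" "q \<preceq> e" "basic p \<subseteq> U" "basic q \<subseteq> U"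
      by (auto simp: Q_def)
    then have "idem_join p q \<in> Q"
      using idem_idem_join idem_join_least e_idem basic_idem_join unfolding Q_def by blast
    then show "\<exists>c\<in>Q. p \<preceq> c \<and> q \<preceq> c"
      using leq_idem_join[OF idem_closed[OF pq(1)] idem_closed[OF pq(2)]] by blast
  qed
  then obtain s where s: "is_sup Q s" using directed_sup_exists by blast
  have si: "idem s" using sup_idem[OF \<open>up_directed Q\<close> s] by (auto simp: Q_def)
  have "stone closure_of U = basic s"
  proof (rule subset_antisym)
    have "U \<subseteq> basic s"
    proof
      fix x assume x: "x \<in> U"
      note u = openin_stoneD(1,2)[OF U x] and xp = openin_stoneD(3)[OF U x]
      obtain p where p: "p \<in> x" "basic p \<subseteq> U" using openin_stoneD(4)[OF U x] by blast
      have ip: "idem p" using ultraD(1) u p by blast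
      have "p \<otimes> e \<in> Q"
        using idem_mult[OF ip e_idem] basic_mult[OF ip e_idem] p
          mult_leq(2)[OF idem_closed[OF ip] e_closed]
        unfolding Q_def by blast
      then have "p \<otimes> e \<preceq> s" using is_sup_upper[OF s] by blast
      then have "s \<in> x" using ultra_upward[OF u(1) ultraD(5)[OF u(1) p(1) u(2)]] si by blast
      then show "x \<in> basic s" using xp by (simp add: basic_def)
    qed
    moreover have "closedin stone (basic s)"
      unfolding closedin_def topspace_stone
      using openin_basic[of "neg s"] basic_neg[OF si] by (auto simp: basic_def)
    ultimately show "stone closure_of U \<subseteq> basic s" by (rule closure_of_minimal)
    show "basic s \<subseteq> stone closure_of U"
    proof
      fix x assume x: "x \<in> basic s"
      then have xp: "x \<in> points" "ultra x" "s \<in> x" by (auto simp: basic_def points_def)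
      have "\<exists>y. y \<in> U \<and> y \<in> T" if T: "x \<in> T" "openin stone T" for T
      proof (rule ccontr)
        assume n: "\<nexists>y. y \<in> U \<and> y \<in> T"
        obtain r where r: "r \<in> x" "basic r \<subseteq> T"
          using openin_stoneD(4)[OF T(2,1)] by blast
        have ir: "idem r" "r \<in> carrier M" using ultraD xp r by blast+
        have "q \<preceq> neg r" if q: "q \<in> Q" for q
        proof (rule idem_leq_ultra)
          have iq: "idem q" "q \<preceq> e" "basic q \<subseteq> U" using q by (auto simp: Q_def)
          show "idem q" "idem (neg r)" using iq ir idem_neg by auto
          fix y assume y: "ultra y" "q \<in> y"
          then have yb: "y \<in> basic q"
            using ultra_upward[OF y iq(2) e_idem] by (simp add: basic_def points_def)
          then have "y \<notin> basic r" using iq(3) r(2) n by blast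
          then show "neg r \<in> y" using yb ultra_neg[OF y(1) ir(1)] by (simp add: basic_def)
        qed
        then have "s \<preceq> neg r" using is_sup_least[OF s, of "neg r"] ir by simp
        then have "neg r \<in> x" using ultra_upward[OF xp(2,3)] idem_neg ir by blast
        then show False using ultra_neg[OF xp(2) ir(1)] r by blast
      qed
      then show "x \<in> stone closure_of U" unfolding in_closure_of topspace_stone
        using xp by blast
    qed
  qed
  then show "openin stone (stone closure_of U)" using openin_basic by simp
qed

section \<open>Values as continuous functions\<close>

definition value_fun :: "'a \<Rightarrow> 'a set \<Rightarrow> real"
  where "value_fun a = (\<lambda>x\<in>points. value_at x a)"

text \<open>An idempotent that witnesses \<open>scalar r\<close> below \<open>a\<close> at
  \<open>x\<close> does so at every point of its basic set. This is lower semicontinuity; the upper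
  half comes from complements.\<close>

lemma openin_value_at_greater:
  assumes "a \<in> carrier M" shows "openin stone {x \<in> points. t < value_at x a}"
  unfolding openin_stone
proof (intro conjI ballI)
  fix x assume "x \<in> {x \<in> points. t < value_at x a}"
  then have x: "x \<in> points" "ultra x" "e \<in> x" "t < value_at x a" by (auto simp: points_def)
  show "\<exists>p\<in>x. basic p \<subseteq> {x \<in> points. t < value_at x a}"
  proof (cases "t < 0")
    case True
    have "t < value_at y a" if "y \<in> points" for y
      using value_at_bounds(1)[of y a] assms that True by (auto simp: points_def)
    then show ?thesis using ultraD(3)[OF x(2)] by (auto simp: basic_def)
  next
    case False
    then obtain r where r: "r \<in> dyadic" "t < r" "r < value_at x a"
      using dyadic_dense[of t "value_at x a"] x(4) value_at_bounds(2)[OF x(2) assms] by auto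
    then obtain p where p: "p \<in> x" "p \<otimes> scalar r \<preceq> p \<otimes> a"
      using leq_at_below_value_at[OF x(2) assms] by (auto simp: leq_at_def)
    have "t < value_at y a" if y: "y \<in> points" "p \<in> y" for y
    proof -
      have "leq_at y (scalar r) a"
        using p(2) y(2) scalar_closed[OF r(1)] assms by (auto simp: leq_at_def)
      then show ?thesis using leq_value_at[of y r a] r y(1) by (simp add: points_def)
    qed
    then show ?thesis using p(1) by (auto simp: basic_def)
  qed
qed auto

lemma value_fun_carrier:
  assumes "a \<in> carrier M" shows "value_fun a \<in> carrier (unit_cfun stone)"
proof -
  have "{x \<in> points. value_at x a < t} = {x \<in> points. 1 - t < value_at x (neg a)}" for t
    using value_at_neg[OF _ _ assms] by (auto simp: points_def)
  then have "openin stone {x \<in> points. value_at x a < t}" for t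
    using openin_value_at_greater[of "neg a" "1 - t"] assms by simp
  then have "openin stone {x \<in> points. value_fun a x < t}" "openin stone {x \<in> points. t < value_fun a x}" for t
    using openin_value_at_greater[OF assms, of t] by (simp_all add: value_fun_def cong: conj_cong)
  then have "continuous_map stone euclideanreal (value_fun a)"
    unfolding continuous_map_upper_lower_semicontinuous_lt topspace_stone by blast
  moreover have "value_fun a \<in> points \<rightarrow>\<^sub>E {0..1}"
    using value_at_bounds assms by (auto simp: value_fun_def points_def)
  ultimately show ?thesis by (simp add: unit_cfun_def topspace_stone)
qed

lemma glue:
  assumes "idem p" "a \<in> carrier M" "b \<in> carrier M"
  shows "p \<otimes> a \<diamond> neg p \<otimes> b"
    and "ultra x \<Longrightarrow> e \<in> x \<Longrightarrow> value_at x (p \<otimes> a \<oplus> neg p \<otimes> b) = (if p \<in> x then value_at x a else value_at x b)"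
proof -
  have pc: "p \<in> carrier M" using assms idem_closed by blast
  show pp: "p \<otimes> a \<diamond> neg p \<otimes> b"
    using perp_mono[OF perp_neg(1)[OF pc] mult_leq(1) mult_leq(1)] assms pc by simp
  show "value_at x (p \<otimes> a \<oplus> neg p \<otimes> b) = (if p \<in> x then value_at x a else value_at x b)" if x: "ultra x" "e \<in> x"
    using value_at_add[OF x pp] value_at_restrict[OF x(1), of p a]
      value_at_restrict[OF x(1), of "neg p" b]
      value_at_restrict_zero[OF x assms(1)] value_at_restrict_zero[OF x idem_neg[OF assms(1)]]
      ultra_neg[OF x(1) assms(1)] assms(2,3) by auto
qed

text \<open>The supremum is formed in the order of \<open>M\<close>, and nothing says in advance
  that its values are pointwise suprema. Both inequalities therefore come from comparing it with
  explicit elements glued near the point.\<close>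

lemma value_at_surj:
  assumes "f \<in> carrier (unit_cfun stone)"
  shows "\<exists>s. s \<preceq> e \<and> value_fun s = f"
proof -
  have f: "f \<in> points \<rightarrow>\<^sub>E {0..1}" "continuous_map stone euclideanreal f"
    using assms by (auto simp: unit_cfun_def topspace_stone)
  then have op: "openin stone {x \<in> points. t < f x}" "openin stone {x \<in> points. f x < t}" for t
    unfolding continuous_map_upper_lower_semicontinuous_lt topspace_stone by blast+
  have f01: "0 \<le> f x \<and> f x \<le> 1" if "x \<in> points" for x
    using f(1) that by (force simp: PiE_iff)
  define S where "S = {a. a \<preceq> e \<and> (\<forall>x\<in>points. value_at x a \<le> f x)}"
  have "up_directed S"
    unfolding up_directed_def
  proof (intro conjI ballI)
    show "S \<subseteq> carrier M" using leqD by (auto simp: S_def)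
    have "\<zero> \<in> S" using value_at_zero f01 by (auto simp: S_def points_def)
    then show "S \<noteq> {}" by blast
    fix a b assume "a \<in> S" "b \<in> S"
    then have ab: "a \<preceq> e" "b \<preceq> e" "\<forall>x\<in>points. value_at x a \<le> f x" "\<forall>x\<in>points. value_at x b \<le> f x"
      by (auto simp: S_def)
    then have c: "a \<in> carrier M" "b \<in> carrier M" using leqD by blast+
    obtain p where p: "idem p" "p \<otimes> b \<preceq> p \<otimes> a" "neg p \<otimes> a \<preceq> neg p \<otimes> b"
      using comparability[OF c] by blast
    have pc: "p \<in> carrier M" using p idem_closed by blast
    \<comment> \<open>The larger of \<open>a\<close> and \<open>b\<close> on each piece: an upper
      bound whose value at a point is the maximum of the two values.\<close>
    let ?c = "p \<otimes> a \<oplus> neg p \<otimes> b"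
    note pp = glue(1)[OF p(1) c]
    have "?c \<preceq> p \<otimes> e \<oplus> neg p \<otimes> e"
      using add_mono[OF mult_split(1)[OF e_closed pc]] mult_mono1(1)[OF ab(1) pc] mult_mono1(1)[OF ab(2), of "neg p"] pc
      by simp
    then have "?c \<preceq> e" using mult_split(2)[OF e_closed pc] by simp
    moreover have "value_at x ?c \<le> f x" if "x \<in> points" for x
      using glue(2)[OF p(1) c, of x] ab that by (auto simp: points_def)
    ultimately have "?c \<in> S" by (simp add: S_def)
    moreover have "a \<preceq> ?c"
      using add_mono[OF pp _ p(3), of "p \<otimes> a"] mult_split(2)[OF c(1) pc] c pc by simp
    moreover have "b \<preceq> ?c"
      using add_mono[OF pp p(2), of "neg p \<otimes> b"] mult_split(2)[OF c(2) pc] c pc by simp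
    ultimately show "\<exists>c\<in>S. a \<preceq> c \<and> b \<preceq> c" by blast
  qed
  then obtain s where s: "is_sup S s" using directed_sup_exists by blast
  have dyadic_multiple: "s \<in> carrier M" using is_sup_closed[OF s] .
  have se: "s \<preceq> e" using is_sup_least[OF s e_closed] by (auto simp: S_def)
  have "value_at x s = f x" if xp: "x \<in> points" for x
  proof (rule antisym; rule ccontr)
    have x: "ultra x" "e \<in> x" using xp by (auto simp: points_def)
    {
      assume "\<not> value_at x s \<le> f x"
      then obtain r where r: "r \<in> dyadic" "f x < r" "r < value_at x s"
        using dyadic_dense[of "f x" "value_at x s"] f01[OF xp] value_at_bounds(2)[OF x(1) dyadic_multiple]
        by auto
      then obtain p where p: "p \<in> x" "basic p \<subseteq> {x \<in> points. f x < r}"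
        using openin_stoneD(4)[OF op(2)[of r], of x] xp by auto
      have ip: "idem p" "p \<in> carrier M" using ultraD x p by blast+
      have rc: "scalar r \<in> carrier M" using scalar_closed r by simp
      \<comment> \<open>The scalar \<open>r\<close> near \<open>x\<close> and \<open>e\<close>
        elsewhere. Since values reflect the order below \<open>e\<close>, this bounds all of
        \<open>S\<close>, yet its value at \<open>x\<close> is only \<open>r\<close>.\<close>
      let ?u = "p \<otimes> scalar r \<oplus> neg p \<otimes> e"
      note pp = glue(1)[OF ip(1) rc e_closed]
      have "a \<preceq> ?u" if a: "a \<in> S" for a
      proof -
        have ae: "a \<preceq> e" "a \<in> carrier M" using a leqD by (auto simp: S_def)
        have "value_at y a \<le> value_at y ?u" if y: "ultra y" "e \<in> y" for y
        proof (cases "p \<in> y")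
          case True
          then have "value_at y ?u = r"
            using glue(2)[OF ip(1) rc e_closed y] value_at_scalar[OF y r(1)] by simp
          moreover have "y \<in> basic p" using y True by (simp add: basic_def points_def)
          then have "f y < r" using p(2) by blast
          moreover have "value_at y a \<le> f y" using a y by (simp add: S_def points_def)
          ultimately show ?thesis by simp
        next
          case False
          then have "value_at y ?u = 1"
            using glue(2)[OF ip(1) rc e_closed y] value_at_scalar[OF y dyadic_one] by simp
          then show ?thesis using value_at_bounds(2)[OF y(1) ae(2)] by simp
        qed
        then have "e \<otimes> a \<preceq> e \<otimes> ?u"
          using value_at_reflects[OF ae(2) perpD(3)[OF pp]] by blast
        then show ?thesis
          using leq_idem(1)[OF e_idem ae(1)] mult_leq(2)[OF e_closed perpD(3)[OF pp]] leq_trans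
          by metis
      qed
      then have "s \<preceq> ?u" using is_sup_least[OF s perpD(3)[OF pp]] by blast
      then have "value_at x s \<le> value_at x ?u"
        using value_at_mono[OF x(1)] leq_at_leq[OF x(1)] by blast
      then have "value_at x s \<le> r"
        using glue(2)[OF ip(1) rc e_closed x] value_at_scalar[OF x r(1)] p(1) by simp
      then show False using r by simp
    next
      assume "\<not> f x \<le> value_at x s"
      then obtain r where r: "r \<in> dyadic" "value_at x s < r" "r < f x"
        using dyadic_dense[of "value_at x s" "f x"] f01[OF xp] value_at_bounds(1)[OF x(1) dyadic_multiple]
        by auto
      then obtain p where p: "p \<in> x" "basic p \<subseteq> {x \<in> points. r < f x}"
        using openin_stoneD(4)[OF op(1)[of r], of x] xp by auto
      have ip: "idem p" "p \<in> carrier M" using ultraD x p by blast+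
      have rc: "scalar r \<in> carrier M" using scalar_closed r by simp
      \<comment> \<open>The scalar \<open>r\<close> near \<open>x\<close> and \<open>\<zero>\<close>
        elsewhere belongs to \<open>S\<close>, hence lies below \<open>s\<close> and pushes the
        value of \<open>s\<close> at \<open>x\<close> up to \<open>r\<close>.\<close>
      have "value_at y (p \<otimes> scalar r) \<le> f y" if y: "y \<in> points" for y
      proof -
        have u: "ultra y" "e \<in> y" using y by (auto simp: points_def)
        show ?thesis
        proof (cases "p \<in> y")
          case True
          then have "y \<in> basic p" using y by (simp add: basic_def)
          then have "r < f y" using p(2) by blast
          then show ?thesis using value_at_restrict[OF u(1) True rc] value_at_scalar[OF u r(1)]
            by simp
        qed (use value_at_restrict_zero[OF u ip(1) _ rc] f01[OF y] in simp)
      qed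
      moreover have "p \<otimes> scalar r \<preceq> e"
        using mult_leq(2)[OF ip(2) rc] scalar_leq_e[OF r(1)] leq_trans by blast
      ultimately have "p \<otimes> scalar r \<preceq> s"
        using is_sup_upper[OF s] by (simp add: S_def)
      then have "value_at x (p \<otimes> scalar r) \<le> value_at x s"
        using value_at_mono[OF x(1)] leq_at_leq[OF x(1)] by blast
      then show False using value_at_restrict[OF x(1) p(1) rc] value_at_scalar[OF x r(1)] r by simp
    }
  qed
  then have "value_fun s = f" using f(1)
    by (intro ext) (auto simp: value_fun_def PiE_iff extensional_def)
  then show ?thesis using se by blast
qed

end


section \<open>The Boolean part and the isomorphism\<close>

locale split_effect_monoid = halved_effect_monoid +
  assumes residue_idem: "effect_algebra.leq M a (compl M (h \<oplus> h)) \<Longrightarrow> effect_monoid.idem M a"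
begin

notation perp (infix \<open>\<diamond>\<close> 50)
notation leq (infix \<open>\<preceq>\<close> 50)

section \<open>The interval of idempotents below the complement of \<open>e\<close>\<close>

definition e_compl :: 'a where "e_compl = neg e"

definition residue :: "'a gorder" where
  "residue = \<lparr>carrier = {a. a \<preceq> e_compl}, eq = (=), le = (\<preceq>)\<rparr>"

lemma carrier_residue [simp]: "carrier residue = {a. a \<preceq> e_compl}"
  and le_residue [simp]: "le residue = (\<preceq>)"
  and eq_residue [simp]: "eq residue = (=)"
  by (simp_all add: residue_def)

lemma e_compl_idem: "idem e_compl" using idem_neg[OF e_idem] by (simp add: e_compl_def)

lemma e_compl_closed [simp]: "e_compl \<in> carrier M" by (simp add: e_compl_def)

lemma below_e_compl_idem: "a \<preceq> e_compl \<Longrightarrow> idem a"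
  using residue_idem by (simp add: e_compl_def e_def)

lemma e_compl_mult_leq: "a \<in> carrier M \<Longrightarrow> e_compl \<otimes> a \<preceq> e_compl"
  using mult_leq(1) by simp

lemma partial_order_residue: "partial_order residue"
proof
qed (auto intro: leq_antisym leq_trans dest: leqD)

interpretation R: partial_order residue by (rule partial_order_residue)

lemma greatest_meet:
  assumes "x \<preceq> e_compl" "y \<preceq> e_compl"
  shows "greatest residue (x \<otimes> y) (Lower residue {x, y})"
proof -
  have c: "x \<in> carrier M" "y \<in> carrier M" using assms leqD by blast+
  then have "x \<otimes> y \<preceq> e_compl" using mult_leq(1) assms leq_trans by blast
  then show ?thesis
    using mult_leq[OF c] idem_glb[OF below_e_compl_idem[OF assms(1)]] assms
    by (auto simp: greatest_def Lower_def)
qed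

lemma least_join:
  assumes "x \<preceq> e_compl" "y \<preceq> e_compl"
  shows "least residue (idem_join x y) (Upper residue {x, y})"
proof -
  have c: "x \<in> carrier M" "y \<in> carrier M" using assms leqD by blast+
  have "idem_join x y \<preceq> e_compl" using idem_join_least[OF e_compl_idem] assms by blast
  then show ?thesis
    using leq_idem_join[OF c] idem_join_least[OF below_e_compl_idem] assms
    by (auto simp: least_def Upper_def)
qed

text \<open>The lattice operation is a chosen greatest lower bound; uniqueness in a partial order
  identifies it with the product.\<close>

lemma meet_residue: "x \<preceq> e_compl \<Longrightarrow> y \<preceq> e_compl \<Longrightarrow> x \<sqinter>\<^bsub>residue\<^esub> y = x \<otimes> y"
  unfolding meet_def inf_def
  by (rule some_equality[where P = "\<lambda>z. greatest residue z (Lower residue {x, y})"])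
    (auto intro: R.greatest_unique greatest_meet)

lemma join_residue: "x \<preceq> e_compl \<Longrightarrow> y \<preceq> e_compl \<Longrightarrow> x \<squnion>\<^bsub>residue\<^esub> y = idem_join x y"
  unfolding join_def sup_def
  by (rule some_equality[where P = "\<lambda>z. least residue z (Upper residue {x, y})"])
    (auto intro: R.least_unique least_join)

lemma greatest_top: "greatest residue e_compl (carrier residue)"
  by (auto simp: greatest_def)

lemma least_bottom: "least residue \<zero> (carrier residue)"
  by (auto simp: least_def dest: leqD)

lemma top_residue: "\<top>\<^bsub>residue\<^esub> = e_compl"
  unfolding top_def 
  by (rule some_equality[where P = "\<lambda>z. greatest residue z (carrier residue)"])
    (blast intro: R.greatest_unique greatest_top)+

lemma bottom_residue: "\<bottom>\<^bsub>residue\<^esub> = \<zero>"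
  unfolding bottom_def 
  by (rule some_equality[where P = "\<lambda>z. least residue z (carrier residue)"])
    (blast intro: R.least_unique least_bottom)+

text \<open>The infimum of \<open>A\<close> is the supremum of its lower bounds. These are directed:
  the members of \<open>A\<close> are idempotent, so one that lies above two elements also lies
  above their join.\<close>

lemma complete_lattice_residue: "complete_lattice residue"
proof (rule R.complete_lattice_criterion1)
  show "\<exists>g. greatest residue g (carrier residue)" using greatest_top by blast
  fix A assume A: "A \<subseteq> carrier residue" "A \<noteq> {}"
  define L where "L = {a. a \<preceq> e_compl \<and> (\<forall>b\<in>A. a \<preceq> b)}"
  have Ai: "idem b" "b \<in> carrier M" if "b \<in> A" for b
    using that A(1) below_e_compl_idem leqD(1) by auto
  have "up_directed L"
    unfolding up_directed_def
  proof (intro conjI ballI)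
    show "L \<subseteq> carrier M" using leqD by (auto simp: L_def)
    have "\<zero> \<in> L" using Ai by (simp add: L_def)
    then show "L \<noteq> {}" by blast
    fix p q assume pq: "p \<in> L" "q \<in> L"
    have c: "p \<in> carrier M" "q \<in> carrier M" using pq leqD by (auto simp: L_def)
    have "idem_join p q \<in> L"
      using idem_join_least[OF e_compl_idem] idem_join_least[OF Ai(1)] pq by (simp add: L_def)
    then show "\<exists>c\<in>L. p \<preceq> c \<and> q \<preceq> c"
      using leq_idem_join[OF c] by blast
  qed
  then obtain i where i: "is_sup L i" using directed_sup_exists by blast
  have "i \<preceq> e_compl" using is_sup_least[OF i e_compl_closed] by (simp add: L_def)
  moreover have "i \<preceq> b" if "b \<in> A" for b
    using is_sup_least[OF i Ai(2)[OF that]] that by (simp add: L_def)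
  moreover have "a \<preceq> i" if "a \<preceq> e_compl" "\<And>b. b \<in> A \<Longrightarrow> a \<preceq> b" for a
    using is_sup_upper[OF i, of a] that by (simp add: L_def)
  ultimately have "greatest residue i (Lower residue A)"
    using A(1) by (auto simp: greatest_def Lower_def)
  then show "\<exists>i. greatest residue i (Lower residue A)" by blast
qed

text \<open>Membership in ultrafilters turns the lattice operations into connectives, so existence
  and uniqueness are both propositional. Uniqueness is what evaluates the \<open>THE\<close> in
  \<open>boolean_em\<close>.\<close>

lemma is_complement_residue:
  assumes "x \<preceq> e_compl"
  shows "is_complement residue x y \<longleftrightarrow> y = e_compl \<otimes> neg x"
proof -
  have x: "idem x" "x \<in> carrier M" using below_e_compl_idem leqD assms by auto
  have i: "idem (e_compl \<otimes> neg x)" using idem_mult[OF e_compl_idem idem_neg[OF x(1)]] .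
  have le: "e_compl \<otimes> neg x \<preceq> e_compl" using e_compl_mult_leq x by simp
  have xv: "e_compl \<in> w" if "ultra w" "x \<in> w" for w
    using ultra_upward[OF that assms e_compl_idem] .
  note mem = ultra_mult_iff[OF _ e_compl_idem idem_neg[OF x(1)]]
  have 1: "x \<otimes> (e_compl \<otimes> neg x) = \<zero>"
    using ultra_mult_iff[OF _ x(1) i] mem ultra_neg[OF _ x(1)] ultraD(4)
    by (intro idem_eq_ultra idem_mult[OF x(1) i]) auto
  have 2: "idem_join x (e_compl \<otimes> neg x) = e_compl"
    using ultra_idem_join_iff[OF _ x(1) i] mem ultra_neg[OF _ x(1)] xv
    by (intro idem_eq_ultra idem_idem_join[OF x(1) i] e_compl_idem) auto
  have "y = e_compl \<otimes> neg x" if y: "y \<preceq> e_compl" "x \<otimes> y = \<zero>" "idem_join x y = e_compl"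
  proof (rule idem_eq_ultra[OF below_e_compl_idem[OF y(1)] i])
    fix w assume w: "ultra w"
    show "y \<in> w \<longleftrightarrow> e_compl \<otimes> neg x \<in> w"
      using ultra_mult_iff[OF w x(1) below_e_compl_idem[OF y(1)]]
        ultra_idem_join_iff[OF w x(1) below_e_compl_idem[OF y(1)]]
        mem[OF w] ultra_neg[OF w x(1)] ultraD(4)[OF w] y(2,3) by auto
  qed
  then show ?thesis
    using 1 2 le assms unfolding is_complement_def top_residue bottom_residue
    by (auto simp: meet_residue join_residue)
qed

lemma complete_boolean_lattice_residue: "complete_boolean_lattice residue"
proof -
  interpret C: complete_lattice residue by (rule complete_lattice_residue)
  show ?thesis
  proof
    fix x y z assume "x \<in> carrier residue" "y \<in> carrier residue" "z \<in> carrier residue"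
    then have le: "x \<preceq> e_compl" "y \<preceq> e_compl" "z \<preceq> e_compl" by simp_all
    then have i: "idem x" "idem y" "idem z"
      and c: "x \<in> carrier M" "y \<in> carrier M" "z \<in> carrier M"
      using below_e_compl_idem leqD(1) by auto
    have "x \<otimes> idem_join y z = idem_join (x \<otimes> y) (x \<otimes> z)"
    proof (rule idem_eq_ultra)
      fix w assume w: "ultra w"
      show "x \<otimes> idem_join y z \<in> w \<longleftrightarrow> idem_join (x \<otimes> y) (x \<otimes> z) \<in> w"
        using i by
          (auto simp: ultra_mult_iff[OF w] ultra_idem_join_iff[OF w] idem_mult idem_idem_join)
    qed (use i idem_mult idem_idem_join in auto)
    moreover have "x \<otimes> y \<preceq> e_compl" "x \<otimes> z \<preceq> e_compl" "idem_join y z \<preceq> e_compl"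
      using le c mult_leq(1) leq_trans idem_join_least[OF e_compl_idem] by blast+
    ultimately show "x \<sqinter>\<^bsub>residue\<^esub> (y \<squnion>\<^bsub>residue\<^esub> z) = (x \<sqinter>\<^bsub>residue\<^esub> y) \<squnion>\<^bsub>residue\<^esub> (x \<sqinter>\<^bsub>residue\<^esub> z)"
      using le by (simp add: meet_residue join_residue)
  next
    fix x assume "x \<in> carrier residue"
    then show "\<exists>y. is_complement residue x y" using is_complement_residue by simp
  qed
qed

section \<open>Order and orthogonality read off from the two components\<close>

lemma e_compl_notin_point: "x \<in> points \<Longrightarrow> e_compl \<notin> x"
  using ultra_neg[OF _ e_idem] by (auto simp: points_def e_compl_def)

lemma value_at_below_e_compl:
  assumes "x \<in> points" "b \<preceq> e_compl" shows "value_at x b = 0"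
  using value_at_restrict_zero[OF _ _ e_compl_idem e_compl_notin_point[OF assms(1)], of b] assms
    leq_idem(1)[OF e_compl_idem assms(2)] leqD(1)[OF assms(2)] by (simp add: points_def)

lemma decompose:
  assumes "a \<in> carrier M"
  shows "e \<otimes> a \<diamond> e_compl \<otimes> a" "e \<otimes> a \<oplus> e_compl \<otimes> a = a"
  using mult_split(1,2)[OF assms e_closed] by (simp_all add: e_compl_def)

text \<open>Values decide the part below \<open>e\<close>, the other part is compared directly, and
  the two parts add up to the element. Injectivity of the isomorphism follows by
  antisymmetry.\<close>

lemma leq_iff_parts:
  assumes a: "a \<in> carrier M" "b \<in> carrier M"
  shows "a \<preceq> b \<longleftrightarrow> (\<forall>x\<in>points. value_at x a \<le> value_at x b) \<and> e_compl \<otimes> a \<preceq> e_compl \<otimes> b"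
proof
  assume "a \<preceq> b"
  then show "(\<forall>x\<in>points. value_at x a \<le> value_at x b) \<and> e_compl \<otimes> a \<preceq> e_compl \<otimes> b"
    using value_at_mono leq_at_leq mult_mono1(1)[of a b e_compl] by (auto simp: points_def)
next
  assume h: "(\<forall>x\<in>points. value_at x a \<le> value_at x b) \<and> e_compl \<otimes> a \<preceq> e_compl \<otimes> b"
  then have "e \<otimes> a \<preceq> e \<otimes> b"
    using value_at_reflects[OF a] by (simp add: points_def)
  then show "a \<preceq> b"
    using add_mono[OF decompose(1)[OF a(2)], of "e \<otimes> a" "e_compl \<otimes> a"] h decompose(2)[OF a(1)] decompose(2)[OF a(2)]
    by simp
qed

text \<open>Both sides complete \<open>e_compl \<otimes> a\<close> to \<open>e_compl\<close>, so
  they are its relative complement.\<close>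

lemma e_compl_neg: "a \<in> carrier M \<Longrightarrow> e_compl \<otimes> neg a = e_compl \<otimes> neg (e_compl \<otimes> a)"
proof -
  assume a: "a \<in> carrier M"
  have vv: "e_compl \<otimes> (e_compl \<otimes> a) = e_compl \<otimes> a"
    using e_compl_idem a by (simp add: idem_def m_assoc[symmetric])
  have 1: "e_compl \<otimes> a \<diamond> e_compl \<otimes> neg a" "e_compl \<otimes> a \<oplus> e_compl \<otimes> neg a = e_compl"
    using mult_add(1,2)[OF perp_neg(1)[OF a] e_compl_closed] perp_neg(2)[OF a] by simp_all
  have 2: "e_compl \<otimes> a \<diamond> e_compl \<otimes> neg (e_compl \<otimes> a)" "e_compl \<otimes> a \<oplus> e_compl \<otimes> neg (e_compl \<otimes> a) = e_compl"
    using mult_add(1,2)[OF perp_neg(1)[of "e_compl \<otimes> a"] e_compl_closed] perp_neg(2)[of "e_compl \<otimes> a"] a vv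
    by simp_all
  show ?thesis using cancel 1 2 by metis
qed

text \<open>Orthogonality is \<open>a \<preceq> neg b\<close>, which splits by
  \<open>leq_iff_parts\<close>; in the Boolean component it amounts to disjointness.\<close>

lemma perp_iff_parts:
  assumes a: "a \<in> carrier M" "b \<in> carrier M"
  shows "a \<diamond> b \<longleftrightarrow> (\<forall>x\<in>points. value_at x a + value_at x b \<le> 1) \<and> e_compl \<otimes> a \<otimes> (e_compl \<otimes> b) = \<zero>"
proof -
  have i: "idem (e_compl \<otimes> a)" "idem (e_compl \<otimes> b)"
    using below_e_compl_idem e_compl_mult_leq a by auto
  have c: "e_compl \<otimes> a \<in> carrier M" "e_compl \<otimes> b \<in> carrier M"
    using a by auto
  have "e_compl \<otimes> a \<preceq> e_compl \<otimes> neg b \<longleftrightarrow> e_compl \<otimes> a \<otimes> (e_compl \<otimes> b) = \<zero>"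
  proof
    assume "e_compl \<otimes> a \<preceq> e_compl \<otimes> neg b"
    also have "\<dots> = e_compl \<otimes> neg (e_compl \<otimes> b)" using e_compl_neg a by simp
    also have "\<dots> \<preceq> neg (e_compl \<otimes> b)" using mult_leq a by simp
    finally have "e_compl \<otimes> a \<otimes> (e_compl \<otimes> b) \<preceq> neg (e_compl \<otimes> b) \<otimes> (e_compl \<otimes> b)"
      using mult_mono1(2) c by blast
    then show "e_compl \<otimes> a \<otimes> (e_compl \<otimes> b) = \<zero>"
      using idem_mult_neg(2)[OF i(2)] leq_zeroD by simp
  next
    assume "e_compl \<otimes> a \<otimes> (e_compl \<otimes> b) = \<zero>"
    then have "e_compl \<otimes> a \<preceq> neg (e_compl \<otimes> b)"
      using idem_orth_add(1)[OF i] perp_iff by blast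
    then have "e_compl \<otimes> (e_compl \<otimes> a) \<preceq> e_compl \<otimes> neg (e_compl \<otimes> b)"
      using mult_mono1(1) by simp
    moreover have "e_compl \<otimes> (e_compl \<otimes> a) = e_compl \<otimes> a"
      using e_compl_idem a(1) by (simp add: idem_def m_assoc[symmetric])
    ultimately show "e_compl \<otimes> a \<preceq> e_compl \<otimes> neg b"
      using e_compl_neg[OF a(2)] by simp
  qed
  moreover have "value_at x a \<le> value_at x (neg b) \<longleftrightarrow> value_at x a + value_at x b \<le> 1" if "x \<in> points" for x
    using value_at_neg[OF _ _ a(2), of x] that by (auto simp: points_def)
  ultimately show ?thesis
    using perp_iff[of a b] leq_iff_parts[OF a(1) neg_closed[OF a(2)]] a by auto
qed

lemma canonical_iso: "(\<lambda>a. (value_fun a, e_compl \<otimes> a)) \<in> em_iso M (unit_cfun stone \<oplus>\<^sub>E boolean_em residue)"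
proof -
  let ?N = "unit_cfun stone \<oplus>\<^sub>E boolean_em residue"
  let ?h = "\<lambda>a. (value_fun a, e_compl \<otimes> a)"
  have pt: "ultra x \<and> e \<in> x" if "x \<in> points" for x using that by (simp add: points_def)
  have car: "carrier ?N = carrier (unit_cfun stone) \<times> {a. a \<preceq> e_compl}"
    by (simp add: em_sum_def boolean_em_def)
  have B: "bij_betw ?h (carrier M) (carrier ?N)"
    unfolding bij_betw_def
  proof (intro conjI subset_antisym inj_onI subsetI)
    fix a b assume ab: "a \<in> carrier M" "b \<in> carrier M" "?h a = ?h b"
    then have "value_fun a x = value_fun b x" for x by simp
    then have "value_at x a = value_at x b" if "x \<in> points" for x
      using that by (metis value_fun_def restrict_apply')
    moreover have "e_compl \<otimes> a = e_compl \<otimes> b" using ab by simp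
    ultimately have "a \<preceq> b" "b \<preceq> a"
      using leq_iff_parts[OF ab(1,2)] leq_iff_parts[OF ab(2,1)] ab(1,2) by auto
    then show "a = b" by (rule leq_antisym)
  next
    fix y assume "y \<in> ?h ` carrier M"
    then show "y \<in> carrier ?N" unfolding car using value_fun_carrier e_compl_mult_leq by auto
  next
    fix y assume y: "y \<in> carrier ?N"
    obtain f b where fb: "y = (f, b)" by (cases y)
    with y have f: "f \<in> carrier (unit_cfun stone)" and b: "b \<preceq> e_compl"
      by (auto simp: car)
    obtain s where s: "s \<preceq> e" "value_fun s = f" using value_at_surj[OF f] by blast
    have c: "s \<in> carrier M" "b \<in> carrier M" using s(1) b leqD by auto
    \<comment> \<open>\<open>s\<close> and \<open>b\<close> lie below \<open>e\<close> and its
      complement, so they can be added, and neither disturbs the component that belongs to the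
      other.\<close>
    have p: "s \<diamond> b" using perp_mono[OF perp_neg(1)[OF e_closed] s(1)] b
      by (simp add: e_compl_def)
    have "value_fun (s \<oplus> b) = f"
    proof -
      have "value_at x (s \<oplus> b) = value_at x s" if "x \<in> points" for x
        using value_at_add[OF _ _ p] value_at_below_e_compl[OF that b] pt[OF that] by simp
      then show ?thesis using s(2) by (auto simp: value_fun_def intro: restrict_ext)
    qed
    moreover have "e_compl \<otimes> (s \<oplus> b) = b"
    proof -
      have "e_compl \<otimes> s = \<zero>"
        using mult_mono1(1)[OF s(1) e_compl_closed] idem_mult_neg(2)[OF e_idem] leq_zeroD
        by (simp add: e_compl_def)
      then show ?thesis using mult_add(2)[OF p e_compl_closed] leq_idem(1)[OF e_compl_idem b] c
        by simp
    qed
    ultimately show "y \<in> ?h ` carrier M" using perpD(3)[OF p] fb by force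
  qed
  have Z: "?h \<zero> = \<zero>\<^bsub>?N\<^esub>"
    using value_at_zero pt
    by (auto simp: em_sum_def boolean_em_def bottom_residue unit_cfun_def topspace_stone value_fun_def intro!: restrict_ext)
  have O: "?h \<one> = \<one>\<^bsub>?N\<^esub>"
    using value_at_one pt
    by (auto simp: em_sum_def boolean_em_def top_residue unit_cfun_def topspace_stone value_fun_def intro!: restrict_ext)
  have N: "?h (neg a) = compl ?N (?h a)" if a: "a \<in> carrier M" for a
  proof -
    have "The (is_complement residue (e_compl \<otimes> a)) = e_compl \<otimes> neg a"
      using is_complement_residue[OF e_compl_mult_leq[OF a]] e_compl_neg[OF a]
      by (intro the_equality) auto
    then show ?thesis
      using value_at_neg[OF _ _ a] pt
      by (auto simp: em_sum_def boolean_em_def unit_cfun_def topspace_stone value_fun_def intro!: restrict_ext)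
  qed
  have P: "a \<sharp> b \<longleftrightarrow> ?h a \<sharp>\<^bsub>?N\<^esub> ?h b" if a: "a \<in> carrier M" "b \<in> carrier M" for a b
  proof -
    have "a \<sharp> b \<longleftrightarrow> a \<diamond> b" using a by (simp add: perp_def)
    then show ?thesis
      unfolding perp_iff_parts[OF a] using e_compl_mult_leq[OF a(1)] e_compl_mult_leq[OF a(2)]
      by (simp add: em_sum_def boolean_em_def bottom_residue meet_residue unit_cfun_def topspace_stone value_fun_def)
  qed
  have A: "?h (a \<oplus> b) = ?h a \<oplus>\<^bsub>?N\<^esub> ?h b" if a: "a \<in> carrier M" "b \<in> carrier M" "a \<sharp> b" for a b
  proof -
    have p: "a \<diamond> b" using a by (simp add: perp_def)
    \<comment> \<open>Disjoint idempotents add up to their join, which is the sum in the Boolean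
      component.\<close>
    have "e_compl \<otimes> (a \<oplus> b) = idem_join (e_compl \<otimes> a) (e_compl \<otimes> b)"
      using mult_add(2)[OF p e_compl_closed] perp_iff_parts[OF a(1,2)] p
        idem_orth_add(2)[OF below_e_compl_idem below_e_compl_idem] e_compl_mult_leq a(1,2) by simp
    then show ?thesis
      using e_compl_mult_leq[OF a(1)] e_compl_mult_leq[OF a(2)] value_at_add[OF _ _ p] pt
      by (auto simp: em_sum_def boolean_em_def join_residue unit_cfun_def topspace_stone value_fun_def intro!: restrict_ext)
  qed
  have T: "?h (a \<otimes> b) = ?h a \<otimes>\<^bsub>?N\<^esub> ?h b" if a: "a \<in> carrier M" "b \<in> carrier M" for a b
    using e_compl_mult_leq[OF a(1)] e_compl_mult_leq[OF a(2)] value_at_mult[OF _ _ a] pt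
      idem_mult_mult[OF e_compl_idem a]
    by (auto simp: em_sum_def boolean_em_def meet_residue unit_cfun_def topspace_stone value_fun_def intro!: restrict_ext)
  show ?thesis
    unfolding em_iso_def by (intro CollectI conjI ballI impI B Z O N P A T)
qed

end

text \<open>The points are sets of elements of \<open>M\<close> and the Boolean algebra is an
  interval of \<open>M\<close>, whence the types of the witnesses. In the extreme cases,
  \<open>h = \<zero>\<close> gives the empty space and \<open>h \<oplus> h = \<one>\<close> the
  one-element Boolean algebra.\<close>

theorem theorem68:
  fixes M :: "('a, 'm) effect_monoid_scheme"
  assumes "directed_complete_effect_monoid M"
  shows "\<exists>(X :: 'a set topology) (B :: 'a gorder).
    compact_space X \<and> Hausdorff_space X \<and> extremally_disconnected_space X \<and>
    complete_boolean_lattice B \<and>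
    M \<cong>\<^sub>E unit_cfun X \<oplus>\<^sub>E boolean_em B"
proof -
  interpret directed_complete_effect_monoid M by (rule assms)
  obtain h where h: "perp h h" "idem (h \<oplus>\<^bsub>M\<^esub> h)" "\<And>a. leq a (neg (h \<oplus>\<^bsub>M\<^esub> h)) \<Longrightarrow> idem a"
    using halvable_part by blast
  interpret split_effect_monoid M h
    by unfold_locales (use h in auto)
  show ?thesis
    using compact_stone Hausdorff_stone extremally_disconnected_stone
      complete_boolean_lattice_residue canonical_iso
    unfolding em_isomorphic_def by blast
qed

end
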